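(* Let $q\ge4$. Then the vanishing set in $\mathbb{C}^q$ of the ideal $E_\Delta\subseteq\mathbb{C}[v_1,\dots,v_q]$ contains a nonzero point; equivalently, there is a nonzero $q\mathbb{Z}$-periodic potential on $\mathbb{Z}$ that is Floquet isospectral to $\mathbf{0}$.
   Context: On $\mathbb{Z}$, let $\Delta$ be the discrete Laplacian $(\Delta u)(n)=u(n-1)+u(n+1)$, and let $V$ be a $q\mathbb{Z}$-periodic potential with values $V(1)=v_1,\dots,V(q)=v_q$ treated as indeterminates. For $z$ a variable, $L_V(z)$ is the $q\times q$ matrix of $\Delta+V$ on functions with $u(n+q)=zu(n)$ (identified with their values at $1,\dots,q$), and $D_V(z,\lambda)=\det(L_V(z)-\lambda I)\in\mathbb{C}[v][z^{\pm1},\lambda]$. $E_\Delta$ is the ideal generated by all coefficients $[z^a\lambda^b](D_V(z,\lambda)-D_{\mathbf{0}}(z,\lambda))$, where $D_{\mathbf{0}}$ is obtained by setting all $v_i=0$. Two $q\mathbb{Z}$-periodic potentials are Floquet isospectral iff $D_V=D_{V'}$. *)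

theory Defs
  imports "Jordan_Normal_Form.Determinant"
begin

text \<open>Index convention: row/column i (0 \<le> i < q) corresponds to site n = i+1,
  and the potential V : nat \<Rightarrow> complex gives V(i+1) = V i, i.e. v_(i+1) = V i.
  L_V(z) is the matrix of (Delta + V) on functions with u(n+q) = z u(n), i.e.
  ((Delta+V)u)(n) = u(n-1) + u(n+1) + V(n) u(n), with u(0) = z^(-1) u(q) and
  u(q+1) = z u(1).  Contributions are added, so small q are also handled.\<close>

definition floquet_matrix :: "nat \<Rightarrow> (nat \<Rightarrow> complex) \<Rightarrow> complex \<Rightarrow> complex mat" where
  "floquet_matrix q V z = mat q q (\<lambda>(i, j).
      (if i = j then V i else 0)
    + (if j = i + 1 then 1 else 0)
    + (if i = j + 1 then 1 else 0)
    + (if i = 0 \<and> j = q - 1 then inverse z else 0)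
    + (if i = q - 1 \<and> j = 0 then z else 0))"

definition floquet_det :: "nat \<Rightarrow> (nat \<Rightarrow> complex) \<Rightarrow> complex \<Rightarrow> complex \<Rightarrow> complex" where
  "floquet_det q V z lam = det (floquet_matrix q V z - lam \<cdot>\<^sub>m 1\<^sub>m q)"

end

theory Submission
  imports Defs "HOL-Computational_Algebra.Fundamental_Theorem_Algebra" "HOL-Library.Poly_Mapping"
begin

text \<open>Consider only potentials that are antisymmetric under a reflection: with
  \<open>m = \<lfloor>q/2\<rfloor>\<close> free values \<open>u\<^sub>1, \<dots>, u\<^sub>m\<close> the characteristic polynomial then differs from the free
  one in at most m coefficients \<open>G\<^sub>1, \<dots>, G\<^sub>m\<close>. The top forms of the \<open>G\<^sub>k\<close> are, up to sign, the elementary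
  symmetric polynomials in the squares \<open>u\<^sub>j\<^sup>2\<close>, so the system has \<open>2\<^sup>m m!\<close> solutions counted with
  multiplicity. Evaluating at the m double eigenvalues
  \<open>2 cos (\<pi>k/q)\<close> of the free operator shows that the lowest forms span the squares of the m independent
  Fourier coefficients of V, so the solution 0 has multiplicity only \<open>2\<^sup>m\<close>, and
  \<open>2\<^sup>m < 2\<^sup>m m!\<close> for \<open>m \<ge> 2\<close>.

  Algebraically: if 0 were the only zero, all \<open>u\<^sub>j\<close> would be nilpotent modulo the ideal of the
  \<open>G\<^sub>k\<close>, and the squares of the Fourier coefficients would force every monomial of degree \<open>m + 1\<close>
  into that ideal. But a residue-like linear functional that annihilates the ideal is nonzero on
  \<open>\<Prod>\<^sub>j u\<^sub>j\<^bsup>2j-1\<^esup>\<close>, which has degree \<open>m\<^sup>2 \<ge> m + 1\<close>.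
  To construct it, substitute \<open>\<lambda> = u\<^sub>j\<close>: since \<open>\<Prod>\<^sub>i (V\<^sub>i - \<lambda>)\<close> vanishes there, the ideal contains
  polynomials of the form \<open>u\<^sub>j\<^sup>q - T\<^sub>j\<close> with \<open>deg T\<^sub>j < q\<close>. These form a Groebner basis, and the
  functional multiplies by the Vandermonde-like determinant that expresses them through the \<open>G\<^sub>k\<close> and
  reads off the coefficient of \<open>\<Prod>\<^sub>j u\<^sub>j\<^bsup>q-1\<^esup>\<close> in the normal form.\<close>

section \<open>Continuants and the Floquet determinant\<close>

text \<open>Determinant of the tridiagonal matrix with diagonal \<open>a 0, ..., a (n - 1)\<close>
  and off-diagonal entries 1. The recursive form works over numbers, over polynomials in the
  spectral variable and over polynomials in the potential alike.\<close>

fun continuant :: "(nat \<Rightarrow> 'a::comm_ring_1) \<Rightarrow> nat \<Rightarrow> 'a" where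
  "continuant a 0 = 1"
| "continuant a (Suc 0) = a 0"
| "continuant a (Suc (Suc n)) = a (Suc n) * continuant a (Suc n) - continuant a n"

text \<open>The part of the Floquet determinant without \<open>z\<close>: the edge that closes the
  path to a cycle contributes minus the continuant of the sites strictly between the two
  ends.\<close>

definition periodic_continuant :: "nat \<Rightarrow> (nat \<Rightarrow> 'a::comm_ring_1) \<Rightarrow> 'a" where
  "periodic_continuant q a = continuant a q - continuant (\<lambda>i. a (Suc i)) (q - 2)"

lemma continuant_cong:
  "(\<And>i. i < n \<Longrightarrow> a i = b i) \<Longrightarrow> continuant a n = continuant b n"
  by (induction a n rule: continuant.induct) auto

lemma periodic_continuant_cong:
  assumes "\<And>i. i < q \<Longrightarrow> a i = b i" "q \<ge> 2"
  shows "periodic_continuant q a = periodic_continuant q b"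
  unfolding periodic_continuant_def
  using assms by (intro arg_cong2[where f = "(-)"] continuant_cong) auto

text \<open>Both sides obey the recursion at the right end. The expansion at the left end is what
  makes the symmetry under reversal provable.\<close>

lemma continuant_left:
  "continuant a (Suc (Suc n)) =
     a 0 * continuant (\<lambda>i. a (Suc i)) (Suc n) - continuant (\<lambda>i. a (Suc (Suc i))) n"
proof (induction n rule: less_induct)
  case (less n)
  consider "n = 0" | "n = 1" | k where "n = Suc (Suc k)"
    by (metis One_nat_def not0_implies_Suc)
  then show ?case
  proof cases
    case 3
    have "continuant a (Suc (Suc n)) =
        a (Suc n) * continuant a (Suc (Suc (Suc k))) - continuant a (Suc (Suc k))"
      using 3 by simp
    also have "\<dots> = a (Suc n) * (a 0 * continuant (\<lambda>i. a (Suc i)) (Suc (Suc k))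
          - continuant (\<lambda>i. a (Suc (Suc i))) (Suc k))
        - (a 0 * continuant (\<lambda>i. a (Suc i)) (Suc k) - continuant (\<lambda>i. a (Suc (Suc i))) k)"
      using less.IH[of "Suc k"] less.IH[of k] 3 by (simp del: continuant.simps)
    also have "\<dots> = a 0 * continuant (\<lambda>i. a (Suc i)) (Suc n)
        - continuant (\<lambda>i. a (Suc (Suc i))) n"
      unfolding 3 by (simp add: algebra_simps)
    finally show ?thesis .
  qed (auto simp: algebra_simps)
qed

lemma continuant_rev: "continuant (\<lambda>i. a (n - 1 - i)) n = continuant a n"
proof (induction n arbitrary: a rule: less_induct)
  case (less n)
  consider "n = 0" | "n = 1" | k where "n = Suc (Suc k)"
    by (metis One_nat_def not0_implies_Suc)
  then show ?case
  proof cases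
    case 3
    have 1: "continuant (\<lambda>i. a (Suc k - Suc i)) (Suc k) = continuant a (Suc k)"
      using less.IH[of "Suc k" a] 3 by simp
    have 2: "continuant (\<lambda>i. a (Suc k - Suc (Suc i))) k = continuant a k"
      using less.IH[of k a] 3 by simp
    show ?thesis
      unfolding 3 using 1 2 by (simp add: continuant_left del: continuant.simps)
        (simp add: continuant_left[symmetric])
  qed auto
qed

lemma periodic_continuant_rev:
  assumes "q \<ge> 2"
  shows "periodic_continuant q (\<lambda>i. a (q - 1 - i)) = periodic_continuant q a"
proof -
  have "continuant (\<lambda>i. a (q - 1 - Suc i)) (q - 2) =
      continuant (\<lambda>i. a (Suc (q - 2 - 1 - i))) (q - 2)"
    using assms by (intro continuant_cong arg_cong[where f = a]) auto
  also have "\<dots> = continuant (\<lambda>i. a (Suc i)) (q - 2)"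
    by (rule continuant_rev)
  finally show ?thesis
    by (simp only: periodic_continuant_def continuant_rev)
qed

lemma continuant_uminus: "continuant (\<lambda>i. - a i) n = (-1) ^ n * continuant a n"
  by (induction a n rule: continuant.induct) (auto simp: algebra_simps)

lemma periodic_continuant_uminus:
  assumes "q \<ge> 2"
  shows "periodic_continuant q (\<lambda>i. - a i) = (-1) ^ q * periodic_continuant q a"
proof -
  have "(-1 :: 'a) ^ (q - 2) = (-1) ^ q"
    using le_Suc_ex[OF assms] by (auto simp: power_add)
  then show ?thesis
    by (simp add: periodic_continuant_def continuant_uminus algebra_simps)
qed

lemma continuant_hom:
  assumes "\<And>x y. h (x - y) = h x - h y" "\<And>x y. h (x * y) = h x * h y" "h 1 = 1"
  shows "h (continuant a n) = continuant (\<lambda>i. h (a i)) n"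
  using assms by (induction a n rule: continuant.induct) auto

lemma periodic_continuant_hom:
  assumes "\<And>x y. h (x - y) = h x - h y" "\<And>x y. h (x * y) = h x * h y" "h 1 = 1"
  shows "h (periodic_continuant q a) = periodic_continuant q (\<lambda>i. h (a i))"
  unfolding periodic_continuant_def by (simp add: assms(1) continuant_hom[of h, OF assms])

section \<open>Determinants of path and cycle matrices\<close>

lemma det_diag_one:
  assumes "A \<in> carrier_mat n n" "\<And>i. i < n \<Longrightarrow> A $$ (i,i) = 1"
    "(\<forall>i j. i < j \<longrightarrow> j < n \<longrightarrow> A $$ (i,j) = 0) \<or> (\<forall>i j. j < i \<longrightarrow> i < n \<longrightarrow> A $$ (i,j) = 0)"
  shows "det A = (1 :: 'a::comm_ring_1)"
proof -
  have "det A = prod_list (diag_mat A)"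
    using assms(3)
  proof
    assume "\<forall>i j. i < j \<longrightarrow> j < n \<longrightarrow> A $$ (i,j) = 0"
    then show ?thesis using assms(1) by (intro det_lower_triangular[of n]) auto
  next
    assume "\<forall>i j. j < i \<longrightarrow> i < n \<longrightarrow> A $$ (i,j) = 0"
    then show ?thesis using assms(1)
      by (intro det_upper_triangular[of _ n]) (auto simp: upper_triangular_def)
  qed
  also have "diag_mat A = replicate n 1"
    using assms(1,2) unfolding diag_mat_def by (intro nth_equalityI) auto
  finally show ?thesis by simp
qed

definition path_matrix :: "(nat \<Rightarrow> 'a::comm_ring_1) \<Rightarrow> nat \<Rightarrow> 'a mat" where
  "path_matrix a n = mat n n (\<lambda>(i, j). if i = j then a i else if i = j + 1 \<or> j = i + 1 then 1 else 0)"

text \<open>The last column has two nonzero entries; the minor of the off-diagonal one has a single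
  entry 1 in its last row, so the expansion reproduces the recursion.\<close>

lemma det_path_matrix: "det (path_matrix a n) = continuant a n"
proof (induction n rule: less_induct)
  case (less n)
  consider "n = 0" | "n = 1" | k where "n = Suc (Suc k)"
    by (metis One_nat_def not0_implies_Suc)
  then show ?case
  proof cases
    case 1
    then show ?thesis by (simp add: path_matrix_def)
  next
    case 2
    then show ?thesis by (simp add: path_matrix_def det_single)
  next
    case 3
    let ?A = "path_matrix a n"
    define B where "B = mat_delete ?A k (Suc k)"
    have A: "?A \<in> carrier_mat n n" by (simp add: path_matrix_def)
    have "det ?A = (\<Sum>i<n. ?A $$ (i,Suc k) * cofactor ?A i (Suc k))"
      by (rule laplace_expansion_column[OF A]) (simp add: 3)
    also have "\<dots> = (\<Sum>i\<in>{k, Suc k}. ?A $$ (i,Suc k) * cofactor ?A i (Suc k))"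
      by (rule sum.mono_neutral_right) (auto simp: 3 path_matrix_def)
    also have "\<dots> = a (Suc k) * det (mat_delete ?A (Suc k) (Suc k)) - det B"
      by (simp add: cofactor_def path_matrix_def 3 B_def algebra_simps)
    also have "mat_delete ?A (Suc k) (Suc k) = path_matrix a (Suc k)"
      by (rule eq_matI) (auto simp: mat_delete_def path_matrix_def 3)
    also have "det B = continuant a k"
    proof -
      have B: "B \<in> carrier_mat (Suc k) (Suc k)"
        unfolding B_def using mat_delete_carrier[OF A, of k "Suc k"] by (simp add: 3)
      have Be: "B $$ (i,j) = (let i' = (if i < k then i else Suc i) in
          if i' = j then a i' else if i' = j + 1 \<or> j = i' + 1 then 1 else 0)"
        if "i < Suc k" "j < Suc k" for i j
        using that by (auto simp: B_def mat_delete_def path_matrix_def 3)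
      have "det B = (\<Sum>j<Suc k. B $$ (k,j) * cofactor B k j)"
        by (rule laplace_expansion_row[OF B]) simp
      also have "\<dots> = (\<Sum>j\<in>{k}. B $$ (k,j) * cofactor B k j)"
        by (rule sum.mono_neutral_right) (auto simp: Be Let_def)
      also have "\<dots> = det (mat_delete B k k)"
        by (simp add: Be cofactor_def)
      also have "mat_delete B k k = path_matrix a k"
        using B by (intro eq_matI) (auto simp: mat_delete_def path_matrix_def Be)
      finally show ?thesis using less.IH[of k] 3 by simp
    qed
    finally show ?thesis using less.IH[of "Suc k"] 3 by simp
  qed
qed

text \<open>Each corner entry alone completes a cyclic permutation of all sites, which gives the
  terms in \<open>z\<close> and \<open>inverse z\<close>; together they have product 1 and leave the
  continuant of the interior. So \<open>z\<close> separates from the potential.\<close>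

lemma floquet_det_eq:
  assumes "q \<ge> 4" "z \<noteq> 0"
  shows "floquet_det q V z lam =
    periodic_continuant q (\<lambda>i. V i - lam) - (-1) ^ q * (z + inverse z)"
proof -
  \<comment> \<open>With \<open>k \<ge> 2\<close> the rows 0, \<open>k\<close> and
    \<open>Suc k\<close> met by the last column are distinct, and the corner entries do not fall on
    the off-diagonals.\<close>
  obtain k where q: "q = Suc (Suc k)" and k: "k \<ge> 2"
    using that[of "q - 2"] assms by auto
  define a where "a = (\<lambda>i. V i - lam)"
  define A where "A = floquet_matrix q V z - lam \<cdot>\<^sub>m 1\<^sub>m q"
  have A: "A \<in> carrier_mat q q" unfolding A_def floquet_matrix_def by (rule minus_carrier_mat) auto
  have Ae: "A $$ (i,j) = (if i = j then a i else if i = j + 1 \<or> j = i + 1 then 1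
      else if i = 0 \<and> j = Suc k then inverse z else if i = Suc k \<and> j = 0 then z else 0)"
    if "i < q" "j < q" for i j
    using that k by (auto simp: A_def floquet_matrix_def a_def q)
  have Ad: "dim_row A = q" "dim_col A = q" using A by auto
  have "det A = (\<Sum>i<q. A $$ (i,Suc k) * cofactor A i (Suc k))"
    by (rule laplace_expansion_column[OF A]) (simp add: q)
  also have "\<dots> = (\<Sum>i\<in>{0, k, Suc k}. A $$ (i,Suc k) * cofactor A i (Suc k))"
    by (rule sum.mono_neutral_right) (auto simp: Ae q)
  also have "\<dots> = a (Suc k) * det (mat_delete A (Suc k) (Suc k)) - det (mat_delete A k (Suc k))
      + inverse z * (-1) ^ Suc k * det (mat_delete A 0 (Suc k))"
    using k by (simp add: cofactor_def Ae q algebra_simps)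
  also have "mat_delete A (Suc k) (Suc k) = path_matrix a (Suc k)"
    by (rule eq_matI) (auto simp: mat_delete_def Ad path_matrix_def q Ae)
  also have "det (mat_delete A k (Suc k)) = continuant a k + (-1) ^ k * z"
  proof -
    define B where "B = mat_delete A k (Suc k)"
    have B: "B \<in> carrier_mat (Suc k) (Suc k)"
      unfolding B_def using mat_delete_carrier[OF A, of k "Suc k"] by (simp add: q)
    have Be: "B $$ (i,j) = (let i' = (if i < k then i else Suc i) in
        if i' = j then a i' else if i' = j + 1 \<or> j = i' + 1 then 1
        else if i' = Suc k \<and> j = 0 then z else 0)"
      if "i < Suc k" "j < Suc k" for i j
      using that by (auto simp: B_def mat_delete_def Ad Ae q)
    have "det B = (\<Sum>j<Suc k. B $$ (k,j) * cofactor B k j)"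
      by (rule laplace_expansion_row[OF B]) simp
    also have "\<dots> = (\<Sum>j\<in>{0,k}. B $$ (k,j) * cofactor B k j)"
      by (rule sum.mono_neutral_right) (auto simp: Be Let_def)
    also have "\<dots> = (-1) ^ k * z * det (mat_delete B k 0) + det (mat_delete B k k)"
      using k by (simp add: Be cofactor_def)
    also have "det (mat_delete B k 0) = 1"
      by (rule det_diag_one[of _ k])
        (use B k in \<open>auto simp: mat_delete_def Be\<close>)
    also have "mat_delete B k k = path_matrix a k"
      using B by (intro eq_matI) (auto simp: mat_delete_def path_matrix_def Be)
    finally show ?thesis by (simp add: det_path_matrix B_def)
  qed
  \<comment> \<open>Apart from the corner entry \<open>z\<close> this minor is upper triangular with
    unit diagonal; deleting the row and column of \<open>z\<close> leaves the path matrix of the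
    interior sites.\<close>
  also have "det (mat_delete A 0 (Suc k)) = 1 + (-1) ^ k * z * continuant (\<lambda>i. a (Suc i)) k"
  proof -
    define B where "B = mat_delete A 0 (Suc k)"
    have B: "B \<in> carrier_mat (Suc k) (Suc k)"
      unfolding B_def using mat_delete_carrier[OF A, of 0 "Suc k"] by (simp add: q)
    have Be: "B $$ (i,j) = (if Suc i = j then a (Suc i) else if i = j \<or> j = i + 2 then 1
        else if i = k \<and> j = 0 then z else 0)"
      if "i < Suc k" "j < Suc k" for i j
      using that by (auto simp: B_def mat_delete_def Ad Ae q)
    have "det B = (\<Sum>i<Suc k. B $$ (i,0) * cofactor B i 0)"
      by (rule laplace_expansion_column[OF B]) simp
    also have "\<dots> = (\<Sum>i\<in>{0,k}. B $$ (i,0) * cofactor B i 0)"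
      by (rule sum.mono_neutral_right) (auto simp: Be)
    also have "\<dots> = det (mat_delete B 0 0) + (-1) ^ k * z * det (mat_delete B k 0)"
      using k by (simp add: Be cofactor_def)
    also have "det (mat_delete B 0 0) = 1"
      by (rule det_diag_one[of _ k])
        (use B k in \<open>auto simp: mat_delete_def Be\<close>)
    also have "mat_delete B k 0 = path_matrix (\<lambda>i. a (Suc i)) k"
      using B by (intro eq_matI) (auto simp: mat_delete_def path_matrix_def Be)
    finally show ?thesis by (simp add: det_path_matrix B_def)
  qed
  finally have "det A = a (Suc k) * continuant a (Suc k) - (continuant a k + (-1) ^ k * z)
      + inverse z * (-1) ^ Suc k * (1 + (-1) ^ k * z * continuant (\<lambda>i. a (Suc i)) k)"
    by (simp add: det_path_matrix)
  also have "inverse z * (-1) ^ Suc k * (1 + (-1) ^ k * z * continuant (\<lambda>i. a (Suc i)) k) =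
      - ((-1) ^ k * inverse z) - continuant (\<lambda>i. a (Suc i)) k"
  proof -
    have "(-1::complex) ^ k * (-1) ^ k = 1"
      by (simp flip: power_mult_distrib)
    then show ?thesis using assms(2) by (simp add: algebra_simps)
  qed
  finally have "det A = periodic_continuant q a - (-1) ^ q * (z + inverse z)"
    by (simp add: periodic_continuant_def q algebra_simps)
  then show ?thesis
    by (simp add: floquet_det_def A_def a_def)
qed

section \<open>Zeros from proper ideals\<close>

definition ring_ideal :: "'a::comm_ring_1 set \<Rightarrow> bool" where
  "ring_ideal J \<longleftrightarrow> 0 \<in> J \<and> (\<forall>x\<in>J. \<forall>y\<in>J. x + y \<in> J) \<and> (\<forall>r. \<forall>x\<in>J. r * x \<in> J)"

lemma ring_ideal_0: "ring_ideal J \<Longrightarrow> 0 \<in> J"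
  and ring_ideal_add: "ring_ideal J \<Longrightarrow> x \<in> J \<Longrightarrow> y \<in> J \<Longrightarrow> x + y \<in> J"
  and ring_ideal_mult: "ring_ideal J \<Longrightarrow> x \<in> J \<Longrightarrow> r * x \<in> J"
  unfolding ring_ideal_def by auto

lemma ring_ideal_mult_right: "ring_ideal J \<Longrightarrow> x \<in> J \<Longrightarrow> x * r \<in> J"
  by (metis ring_ideal_mult mult.commute)

lemma ring_ideal_uminus: "ring_ideal J \<Longrightarrow> x \<in> J \<Longrightarrow> - x \<in> J"
  by (metis ring_ideal_mult mult_minus1)

lemma ring_ideal_diff: "ring_ideal J \<Longrightarrow> x \<in> J \<Longrightarrow> y \<in> J \<Longrightarrow> x - y \<in> J"
  by (metis ring_ideal_add ring_ideal_uminus diff_conv_add_uminus)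

lemma ring_ideal_sum: "ring_ideal J \<Longrightarrow> (\<And>i. i \<in> A \<Longrightarrow> f i \<in> J) \<Longrightarrow> sum f A \<in> J"
  by (induction A rule: infinite_finite_induct) (auto intro: ring_ideal_0 ring_ideal_add)

text \<open>Colon ideals are the only means by which ideals are enlarged below. Such an ideal is
  proper exactly when \<open>p\<close> lies outside \<open>J\<close>, so no maximal ideal has to be
  chosen.\<close>

lemma ring_ideal_colon:
  assumes "ring_ideal J"
  shows "ring_ideal {f. p * f \<in> J}" "J \<subseteq> {f. p * f \<in> J}"
  using assms by (auto simp: ring_ideal_def distrib_left mult.left_commute)

lemma (in comm_ring_hom) poly_map_poly_add:
  "poly (map_poly hom (p + q)) u = poly (map_poly hom p) u + poly (map_poly hom q) u"
  by (induction p q rule: poly_induct2) (auto simp: map_poly_pCons hom_add algebra_simps)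

lemma (in comm_ring_hom) poly_map_poly_linear_mult:
  "poly (map_poly hom ([:- c, 1:] * r)) u = (u - hom c) * poly (map_poly hom r) u"
proof -
  have smult: "poly (map_poly hom (smult b p)) u = hom b * poly (map_poly hom p) u" for b p
    by (induction p) (auto simp: map_poly_pCons hom_mult algebra_simps)
  have "[:- c, 1:] * r = smult (- c) r + pCons 0 r"
    by simp
  then show ?thesis
    by (simp only: poly_map_poly_add smult) (simp add: map_poly_pCons hom_uminus algebra_simps)
qed

text \<open>Peel off the linear factors of p one after the other; the factor u - c either is
  harmless (c = 0) or becomes an element of the colon ideal.\<close>

lemma nilpotent_or_nonzero_value:
  fixes h :: "complex \<Rightarrow> 'a::comm_ring_1"
  assumes "comm_ring_hom h" "ring_ideal J" "p \<noteq> 0" "poly (map_poly h p) u * f \<in> J"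
  shows "(\<exists>n. u ^ n * f \<in> J) \<or>
    (\<exists>c J'. c \<noteq> 0 \<and> ring_ideal J' \<and> J \<subseteq> J' \<and> 1 \<notin> J' \<and> u - h c \<in> J')"
  using assms(3,4)
proof (induction "degree p" arbitrary: p f)
  case 0
  interpret comm_ring_hom h by fact
  obtain b where p: "p = [:b:]" and b: "b \<noteq> 0"
    using 0 by (metis degree_eq_zeroE pCons_eq_0_iff)
  have "h (inverse b) * (h b * f) \<in> J"
    using 0 p by (intro ring_ideal_mult[OF assms(2), of "h b * f"]) (simp add: map_poly_pCons)
  also have "h (inverse b) * (h b * f) = h (inverse b * b) * f"
    by (simp only: hom_mult mult.assoc)
  also have "inverse b * b = 1" using b by simp
  finally have "u ^ 0 * f \<in> J" by simp
  then show ?case by blast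
next
  case (Suc d)
  interpret comm_ring_hom h by fact
  obtain c where "poly p c = 0"
    using Suc by (metis fundamental_theorem_of_algebra_alt degree_pCons_0 nat.distinct(1))
  then obtain r where p: "p = [:- c, 1:] * r"
    by (metis poly_eq_0_iff_dvd dvdE)
  have r: "r \<noteq> 0" "d = degree r"
    using Suc p by (auto simp: degree_mult_eq simp del: mult_pCons_left)
  have "poly (map_poly h r) u * ((u - h c) * f) \<in> J"
    using Suc.prems(2) unfolding p poly_map_poly_linear_mult by (simp add: mult_ac)
  from Suc.hyps(1)[OF r(2,1) this] show ?case
  proof (elim disjE exE)
    fix n assume n: "u ^ n * ((u - h c) * f) \<in> J"
    show ?thesis
    proof (cases "c = 0")
      case True
      then have "u ^ Suc n * f \<in> J" using n by (simp add: mult_ac)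
      then show ?thesis by blast
    next
      case False
      let ?J = "{g. (u ^ n * f) * g \<in> J}"
      show ?thesis
      proof (cases "1 \<in> ?J")
        case True
        then show ?thesis by auto
      next
        case 1: False
        have "u - h c \<in> ?J" using n by (simp add: mult_ac)
        then show ?thesis
          using False 1 ring_ideal_colon[OF assms(2), of "u ^ n * f"] by blast
      qed
    qed
  qed blast
qed

text \<open>One step of a Nullstellensatz. If \<open>u\<close> is nilpotent modulo \<open>J\<close>,
  the colon ideal by its last power outside \<open>J\<close> contains \<open>u\<close>, which gives
  the value 0; otherwise the preceding dichotomy with \<open>f = 1\<close> gives a nonzero
  value.\<close>

lemma exists_value:
  fixes h :: "complex \<Rightarrow> 'a::comm_ring_1"
  assumes "comm_ring_hom h" "ring_ideal J" "1 \<notin> J" "p \<noteq> 0" "poly (map_poly h p) u \<in> J"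
  shows "\<exists>c J'. ring_ideal J' \<and> J \<subseteq> J' \<and> 1 \<notin> J' \<and> u - h c \<in> J'"
proof (cases "\<exists>n. u ^ n \<in> J")
  case True
  interpret comm_ring_hom h by fact
  define n where "n = (LEAST n. u ^ n \<in> J)"
  have n: "u ^ n \<in> J" unfolding n_def using True by (metis LeastI_ex)
  then have "n \<noteq> 0" using assms(3) by (metis power_0)
  then obtain k where k: "n = Suc k" using not0_implies_Suc by blast
  have "u ^ k \<notin> J" using not_less_Least[of k "\<lambda>n. u ^ n \<in> J"] k n_def by auto
  moreover have "u - h 0 \<in> {g. u ^ k * g \<in> J}" using n k by (simp add: mult_ac)
  ultimately show ?thesis
    using ring_ideal_colon[OF assms(2), of "u ^ k"]
    by (intro exI[of _ 0] exI[of _ "{g. u ^ k * g \<in> J}"]) auto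
next
  case False
  then show ?thesis
    using nilpotent_or_nonzero_value[OF assms(1,2,4), of u 1] assms(5) by auto
qed

text \<open>The elements receive their values one after the other; an algebraic relation modulo
  \<open>J\<close> persists modulo every larger ideal.\<close>

lemma exists_joint_value:
  fixes h :: "complex \<Rightarrow> 'a::comm_ring_1" and u :: "nat \<Rightarrow> 'a"
  assumes "comm_ring_hom h" "ring_ideal J" "1 \<notin> J"
    and "\<And>i. i < n \<Longrightarrow> \<exists>p. p \<noteq> 0 \<and> poly (map_poly h p) (u i) \<in> J"
  shows "\<exists>c J'. ring_ideal J' \<and> J \<subseteq> J' \<and> 1 \<notin> J' \<and> (\<forall>i<n. u i - h (c i) \<in> J')"
  using assms(4)
proof (induction n)
  case 0
  then show ?case using assms by auto
next
  case (Suc n)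
  then obtain c J' where J': "ring_ideal J'" "J \<subseteq> J'" "1 \<notin> J'"
    and c: "\<forall>i<n. u i - h (c i) \<in> J'" by (metis less_Suc_eq)
  obtain p where "p \<noteq> 0" "poly (map_poly h p) (u n) \<in> J"
    using Suc.prems by blast
  with exists_value[OF assms(1) J'(1,3)] J'(2) obtain b J'' where
    J'': "ring_ideal J''" "J' \<subseteq> J''" "1 \<notin> J''" "u n - h b \<in> J''" by blast
  have "u i - h ((c(n := b)) i) \<in> J''" if "i < Suc n" for i
    using that J''(2,4) c by (cases "i = n") auto
  with J''(1-3) J'(2) show ?case
    by (intro exI[of _ "c(n := b)"] exI[of _ J'']) auto
qed

text \<open>An element that is not nilpotent gets a nonzero value first, and all values are then
  chosen modulo the enlarged ideal. Its final value cannot be 0, since a nonzero constant, hence a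
  unit, would then lie in a proper ideal.\<close>

lemma nilpotent_or_nonzero_joint_value:
  fixes h :: "complex \<Rightarrow> 'a::comm_ring_1" and u :: "nat \<Rightarrow> 'a"
  assumes "comm_ring_hom h" "ring_ideal J"
    and alg: "\<And>i. i < n \<Longrightarrow> \<exists>p. p \<noteq> 0 \<and> poly (map_poly h p) (u i) \<in> J"
  shows "(\<forall>i<n. \<exists>k. u i ^ k \<in> J) \<or>
    (\<exists>c J'. ring_ideal J' \<and> J \<subseteq> J' \<and> 1 \<notin> J' \<and> (\<forall>i<n. u i - h (c i) \<in> J') \<and> (\<exists>i<n. c i \<noteq> 0))"
proof (cases "\<forall>i<n. \<exists>k. u i ^ k \<in> J")
  case False
  interpret comm_ring_hom h by fact
  obtain i where i: "i < n" and nil: "\<nexists>k. u i ^ k \<in> J" using False by blast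
  obtain p where "p \<noteq> 0" "poly (map_poly h p) (u i) \<in> J" using alg[OF i] by blast
  with nilpotent_or_nonzero_value[OF assms(1,2), of p "u i" 1] nil
  obtain b J' where J': "b \<noteq> 0" "ring_ideal J'" "J \<subseteq> J'" "1 \<notin> J'" "u i - h b \<in> J'" by auto
  obtain c J'' where J'': "ring_ideal J''" "J' \<subseteq> J''" "1 \<notin> J''"
    and c: "\<forall>i<n. u i - h (c i) \<in> J''"
    using exists_joint_value[OF assms(1) J'(2,4), of n u] alg J'(3) by blast
  have "c i \<noteq> 0"
  proof
    assume "c i = 0"
    then have "u i \<in> J''" using c i by auto
    moreover have "u i - h b \<in> J''" using J'(5) J''(2) by blast
    ultimately have "u i - (u i - h b) \<in> J''" by (rule ring_ideal_diff[OF J''(1)])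
    then have "h (inverse b) * h b \<in> J''"
      by (intro ring_ideal_mult[OF J''(1)]) simp
    moreover have "h (inverse b) * h b = 1"
      using J'(1) by (simp flip: hom_mult)
    ultimately show False using J''(3) by simp
  qed
  then show ?thesis using J'' J'(3) c i by blast
qed simp

section \<open>Polynomials and the top coefficient functional\<close>

text \<open>Monomials are multisets of variable indices: the sum of multisets is the product of
  monomials and \<open>size\<close> is the total degree.\<close>

type_synonym mvpoly = "nat multiset \<Rightarrow>\<^sub>0 complex"

definition cst :: "complex \<Rightarrow> mvpoly" where "cst c = Poly_Mapping.single {#} c"

definition ind :: "nat \<Rightarrow> mvpoly" where "ind i = Poly_Mapping.single {#i#} 1"

definition supported :: "nat multiset set \<Rightarrow> mvpoly set" where
  "supported A = {f. Poly_Mapping.keys f \<subseteq> A}"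

interpretation cst: comm_ring_hom cst
  by unfold_locales (auto simp: cst_def single_add mult_single)

lemma cst_inverse: "c \<noteq> 0 \<Longrightarrow> cst c * cst (inverse c) = 1"
  by (simp flip: cst.hom_mult)

lemma mvpoly_eq_sum: "f = (\<Sum>a\<in>Poly_Mapping.keys f. Poly_Mapping.single a (poly_mapping.lookup f a))"
  for f :: mvpoly
  by (rule poly_mapping_eqI)
     (auto simp: lookup_sum lookup_single when_def sum.delta in_keys_iff)

lemma supported_induct [consumes 1, case_names zero single add]:
  assumes "f \<in> supported A" "P 0" "\<And>a c. a \<in> A \<Longrightarrow> P (Poly_Mapping.single a c)"
    "\<And>f g. P f \<Longrightarrow> P g \<Longrightarrow> P (f + g)"
  shows "P f"
proof -
  have "P (\<Sum>a\<in>B. Poly_Mapping.single a (poly_mapping.lookup f a))"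
    if "finite B" "B \<subseteq> A" for B
    using that by (induction B) (auto intro: assms)
  from this[of "Poly_Mapping.keys f"] show ?thesis
    using assms(1) mvpoly_eq_sum[of f] by (simp add: supported_def)
qed

lemma mvpoly_induct [case_names zero single add]:
  assumes "P 0" "\<And>a c. P (Poly_Mapping.single a c)" "\<And>f g. P f \<Longrightarrow> P g \<Longrightarrow> P (f + g)"
  shows "P (f :: mvpoly)"
  by (rule supported_induct[of f UNIV P]) (auto simp: supported_def assms)

lemma supported_0 [simp]: "0 \<in> supported A"
  by (simp add: supported_def)

lemma supported_mono: "f \<in> supported A \<Longrightarrow> A \<subseteq> B \<Longrightarrow> f \<in> supported B"
  by (auto simp: supported_def)

lemma supported_add: "f \<in> supported A \<Longrightarrow> g \<in> supported A \<Longrightarrow> f + g \<in> supported A"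
  unfolding supported_def using keys_add[of f g] by blast

lemma supported_uminus: "f \<in> supported A \<Longrightarrow> - f \<in> supported A"
  by (simp add: supported_def)

lemma supported_diff: "f \<in> supported A \<Longrightarrow> g \<in> supported A \<Longrightarrow> f - g \<in> supported A"
  by (metis supported_add supported_uminus diff_conv_add_uminus)

lemma supported_sum: "(\<And>i. i \<in> I \<Longrightarrow> f i \<in> supported A) \<Longrightarrow> sum f I \<in> supported A"
  by (induction I rule: infinite_finite_induct) (auto intro: supported_add)

lemma supported_mult:
  assumes "f \<in> supported A" "g \<in> supported B" "\<And>a b. a \<in> A \<Longrightarrow> b \<in> B \<Longrightarrow> a + b \<in> C"
  shows "f * g \<in> supported C"
  unfolding supported_def using keys_mult[of f g] assms by (fastforce simp: supported_def)

lemma supported_single: "a \<in> A \<Longrightarrow> Poly_Mapping.single a c \<in> supported A"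
  by (simp add: supported_def)

definition linear_ext :: "(nat multiset \<Rightarrow> complex) \<Rightarrow> mvpoly \<Rightarrow> complex" where
  "linear_ext g f = (\<Sum>a\<in>Poly_Mapping.keys f. poly_mapping.lookup f a * g a)"

lemma linear_ext_0 [simp]: "linear_ext g 0 = 0"
  by (simp add: linear_ext_def)

lemma linear_ext_single [simp]: "linear_ext g (Poly_Mapping.single a c) = c * g a"
  by (simp add: linear_ext_def)

lemma linear_ext_add: "linear_ext g (f + f') = linear_ext g f + linear_ext g f'"
  unfolding linear_ext_def by (rule setsum_keys_plus_distrib) (auto simp: algebra_simps)

lemma linear_ext_cst: "linear_ext g (cst c * f) = c * linear_ext g f"
  by (induction f rule: mvpoly_induct)
     (auto simp: cst_def mult_single linear_ext_add algebra_simps)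

lemma linear_ext_uminus: "linear_ext g (- f) = - linear_ext g f"
  using linear_ext_cst[of g "-1" f] by (simp add: cst.hom_uminus)

lemma linear_ext_diff: "linear_ext g (f - f') = linear_ext g f - linear_ext g f'"
  using linear_ext_add[of g f "- f'"] by (simp add: linear_ext_uminus)

lemma linear_ext_sum: "linear_ext g (sum f A) = (\<Sum>i\<in>A. linear_ext g (f i))"
  by (induction A rule: infinite_finite_induct) (auto simp: linear_ext_add)

lemma ind_power: "ind j ^ n = Poly_Mapping.single (replicate_mset n j) 1"
  by (induction n) (auto simp: ind_def mult_single)

text \<open>Gaussian elimination for a homogeneous system with more unknowns (\<open>A\<close>) than
  equations (\<open>S\<close>): equation \<open>t\<close> eliminates a pivot unknown
  \<open>k\<close>, whose value is recovered at the end.\<close>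

lemma exists_linear_relation:
  fixes a :: "'i \<Rightarrow> 't \<Rightarrow> complex"
  assumes "finite A" "finite S" "card S < card A"
  shows "\<exists>c. (\<exists>n\<in>A. c n \<noteq> 0) \<and> (\<forall>t\<in>S. (\<Sum>n\<in>A. c n * a n t) = 0)"
  using assms(2,1,3)
proof (induction S arbitrary: A a)
  case empty
  then have "A \<noteq> {}" by auto
  then show ?case by (intro exI[of _ "\<lambda>_. 1"]) auto
next
  case (insert t S)
  show ?case
  proof (cases "\<forall>n\<in>A. a n t = 0")
    case True
    then show ?thesis using insert.IH[of A a] insert.prems insert.hyps by auto
  next
    case False
    then obtain k where k: "k \<in> A" "a k t \<noteq> 0" by auto
    define b where "b n s = a n s - a n t / a k t * a k s" for n s
    have "card S < card (A - {k})"
      using insert.prems insert.hyps k by simp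
    then obtain c where c: "\<exists>n\<in>A - {k}. c n \<noteq> 0" "\<forall>s\<in>S. (\<Sum>n\<in>A - {k}. c n * b n s) = 0"
      using insert.IH[of "A - {k}" b] insert.prems by blast
    define d where "d = c(k := - (\<Sum>n\<in>A - {k}. c n * a n t / a k t))"
    have d: "(\<Sum>n\<in>A. d n * a n s) = (\<Sum>n\<in>A - {k}. c n * b n s)" for s
    proof -
      have "(\<Sum>n\<in>A. d n * a n s) = d k * a k s + (\<Sum>n\<in>A - {k}. d n * a n s)"
        using k insert.prems by (simp add: sum.remove)
      also have "(\<Sum>n\<in>A - {k}. d n * a n s) = (\<Sum>n\<in>A - {k}. c n * a n s)"
        by (rule sum.cong) (auto simp: d_def)
      also have "d k * a k s + \<dots> = (\<Sum>n\<in>A - {k}. c n * b n s)"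
        by (simp add: d_def b_def sum_distrib_left sum_subtractf right_diff_distrib mult_ac)
      finally show ?thesis .
    qed
    have "(\<Sum>n\<in>A. d n * a n t) = 0"
      unfolding d using k by (simp add: b_def)
    moreover have "\<exists>n\<in>A. d n \<noteq> 0"
      using c(1) by (auto simp: d_def)
    ultimately show ?thesis using c(2) d by auto
  qed
qed

section \<open>Normal forms under the rewriting of q-th powers of the variables\<close>

locale monomial_rewriting =
  fixes m q :: nat and T :: "nat \<Rightarrow> mvpoly"
  assumes T: "j < m \<Longrightarrow> T j \<in> supported {a. set_mset a \<subseteq> {..<m} \<and> size a < q}"
begin

definition pivot :: "nat multiset \<Rightarrow> nat" where
  "pivot a = (LEAST j. j < m \<and> q \<le> count a j)"

definition top_mset :: "nat multiset" where
  "top_mset = (\<Sum>j<m. replicate_mset (q - 1) j)"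

lemma pivot: "j < m \<Longrightarrow> q \<le> count a j \<Longrightarrow> pivot a < m \<and> q \<le> count a (pivot a)"
  unfolding pivot_def by (rule LeastI[of "\<lambda>j. j < m \<and> q \<le> count a j"]) auto

lemma size_T: "j < m \<Longrightarrow> b \<in> Poly_Mapping.keys (T j) \<Longrightarrow> size b < q"
  using T[of j] by (auto simp: supported_def)

lemma size_reduce:
  assumes "q \<le> count a j" "size b < q"
  shows "size (a - replicate_mset q j + b) < size a"
proof -
  have sub: "replicate_mset q j \<subseteq># a"
    using assms(1) by (simp add: count_le_replicate_mset_subset_eq)
  have "size (replicate_mset q j) \<le> size a" by (rule size_mset_mono[OF sub])
  then show ?thesis
    using assms(2) by (simp only: size_union size_Diff_submset[OF sub] size_replicate_mset)
qed

text \<open>Coefficient of \<open>top_mset\<close> in the normal form of the monomial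
  \<open>a\<close>, where \<open>ind j ^ q\<close> is replaced by \<open>T j\<close>, always at the
  variable \<open>pivot a\<close>. Every monomial of \<open>T j\<close> has degree below
  \<open>q\<close>, so the degree drops.\<close>

function top_coeff :: "nat multiset \<Rightarrow> complex" where
  "top_coeff a = (if \<exists>j<m. q \<le> count a j
     then \<Sum>b\<in>Poly_Mapping.keys (T (pivot a)). poly_mapping.lookup (T (pivot a)) b *
            top_coeff (a - replicate_mset q (pivot a) + b)
     else if a = top_mset then 1 else 0)"
  by auto
termination
proof (relation "measure size")
  fix a b
  assume "\<exists>j<m. q \<le> count a j" and b: "b \<in> Poly_Mapping.keys (T (pivot a))"
  then have p: "pivot a < m" "q \<le> count a (pivot a)" using pivot by blast+
  then show "(a - replicate_mset q (pivot a) + b, a) \<in> measure size"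
    using size_reduce[OF _ size_T[OF p(1) b]] by simp
qed simp

declare top_coeff.simps [simp del]

abbreviation top_functional :: "mvpoly \<Rightarrow> complex" where
  "top_functional \<equiv> linear_ext top_coeff"

lemma top_coeff_reduce:
  assumes "pivot (a + replicate_mset q j) = j" "j < m"
  shows "top_coeff (a + replicate_mset q j) = top_functional (Poly_Mapping.single a 1 * T j)"
proof -
  have "top_coeff (a + replicate_mset q j) = (\<Sum>b\<in>Poly_Mapping.keys (T j).
      poly_mapping.lookup (T j) b * top_coeff (a + b))"
    using assms by (subst top_coeff.simps) (auto intro!: exI[of _ j])
  also have "\<dots> = top_functional (Poly_Mapping.single a 1 * T j)"
    by (subst (3) mvpoly_eq_sum) (simp add: sum_distrib_left mult_single linear_ext_sum)
  finally show ?thesis .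
qed

text \<open>Lifts a rule from monomials to polynomials. Only the monomials of \<open>f\<close> have
  to obey the rule, so an induction hypothesis for small monomials can be fed in.\<close>

lemma linear_ext_mult_single:
  assumes "\<And>b. b \<in> Poly_Mapping.keys f \<Longrightarrow> g (b + c) = linear_ext g (Poly_Mapping.single b 1 * h)"
  shows "linear_ext g (f * Poly_Mapping.single c 1) = linear_ext g (f * h)"
proof -
  have "f \<in> supported (Poly_Mapping.keys f)" by (simp add: supported_def)
  then show ?thesis
  proof (induction rule: supported_induct)
    case (single a d)
    have "Poly_Mapping.single a d * h = cst d * (Poly_Mapping.single a 1 * h)"
      by (simp add: cst_def mult_single flip: mult.assoc)
    then show ?case
      using assms[OF single] by (simp add: mult_single linear_ext_cst)
  qed (auto simp: distrib_right linear_ext_add)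
qed

text \<open>The leading monomials are coprime, hence the result of the rewriting does not depend on
  the choice of the variable that is reduced first.\<close>

lemma top_coeff_add_replicate:
  assumes "j < m"
  shows "top_coeff (a + replicate_mset q j) = top_functional (Poly_Mapping.single a 1 * T j)"
  using assms
proof (induction "size a" arbitrary: a j rule: less_induct)
  case less
  define i where "i = pivot (a + replicate_mset q j)"
  show ?case
  proof (cases "i = j")
    case True
    then show ?thesis using top_coeff_reduce[of a j] less.prems i_def by simp
  next
    case False
    have i: "i < m" "q \<le> count (a + replicate_mset q j) i"
      using pivot[of j "a + replicate_mset q j"] less.prems by (auto simp: i_def)
    then have "replicate_mset q i \<subseteq># a"
      using False by (simp add: count_le_replicate_mset_subset_eq)
    then obtain a' where a: "a = a' + replicate_mset q i"
      by (metis subset_mset.diff_add)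
    have split: "Poly_Mapping.single (a' + c) (1::complex) =
        Poly_Mapping.single a' 1 * Poly_Mapping.single c 1" for c
      by (simp add: mult_single)
    have swap: "a + replicate_mset q j = (a' + replicate_mset q j) + replicate_mset q i"
      by (simp add: a ac_simps)
    have "pivot ((a' + replicate_mset q j) + replicate_mset q i) = i"
      unfolding swap[symmetric] by (rule i_def[symmetric])
    then have "top_coeff (a + replicate_mset q j) =
        top_functional (Poly_Mapping.single (a' + replicate_mset q j) 1 * T i)"
      unfolding swap by (rule top_coeff_reduce) (rule i(1))
    also have "\<dots> = top_functional ((Poly_Mapping.single a' 1 * T i) *
        Poly_Mapping.single (replicate_mset q j) 1)"
      by (simp add: split mult_ac)
    also have "\<dots> = top_functional ((Poly_Mapping.single a' 1 * T i) * T j)"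
    proof (rule linear_ext_mult_single)
      fix b assume "b \<in> Poly_Mapping.keys (Poly_Mapping.single a' 1 * T i)"
      then obtain b' where "b = a' + b'" "b' \<in> Poly_Mapping.keys (T i)"
        using keys_mult[of "Poly_Mapping.single a' 1" "T i"] by auto
      then have "size b < size a" using size_T[OF i(1)] a by simp
      then show "top_coeff (b + replicate_mset q j) = top_functional (Poly_Mapping.single b 1 * T j)"
        using less by blast
    qed
    also have "\<dots> = top_functional ((Poly_Mapping.single a' 1 * T j) * T i)"
      by (simp add: mult_ac)
    also have "\<dots> = top_functional ((Poly_Mapping.single a' 1 * T j) *
        Poly_Mapping.single (replicate_mset q i) 1)"
    proof (rule linear_ext_mult_single[symmetric])
      fix b assume "b \<in> Poly_Mapping.keys (Poly_Mapping.single a' 1 * T j)"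
      then obtain b' where "b = a' + b'" "b' \<in> Poly_Mapping.keys (T j)"
        using keys_mult[of "Poly_Mapping.single a' 1" "T j"] by auto
      then have "size b < size a" using size_T[OF less.prems] a by simp
      then show "top_coeff (b + replicate_mset q i) = top_functional (Poly_Mapping.single b 1 * T i)"
        using less i by blast
    qed
    also have "\<dots> = top_functional (Poly_Mapping.single a 1 * T j)"
      by (simp add: a split mult_ac)
    finally show ?thesis .
  qed
qed

text \<open>The largest ideal inside the kernel of \<open>top_functional\<close>. It stands in for
  the ideal generated by the rewriting relations; a single nonzero value of the functional proves
  non-membership.\<close>

definition annihilator :: "mvpoly set" where
  "annihilator = {f. \<forall>g. top_functional (f * g) = 0}"

lemma ring_ideal_annihilator: "ring_ideal annihilator"
proof -
  have "top_functional (r * f * g) = 0" if "\<forall>g. top_functional (f * g) = 0" for r f g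
    using that[rule_format, of "r * g"] by (simp add: mult_ac)
  then show ?thesis
    by (auto simp: ring_ideal_def annihilator_def distrib_right linear_ext_add)
qed

lemma relation_in_annihilator:
  assumes "j < m"
  shows "ind j ^ q - T j \<in> annihilator"
proof -
  have "top_functional (g * ind j ^ q) = top_functional (g * T j)" for g
    unfolding ind_power by (rule linear_ext_mult_single) (simp add: top_coeff_add_replicate assms)
  then show ?thesis
    by (simp add: annihilator_def linear_ext_diff algebra_simps)
qed

lemma count_top_mset: "count top_mset j = (if j < m then q - 1 else 0)"
  by (simp add: top_mset_def count_sum)

lemma size_top_mset: "size top_mset = m * (q - 1)"
  by (simp add: top_mset_def)

lemma top_coeff_top_mset: "q > 0 \<Longrightarrow> top_coeff top_mset = 1"
  by (subst top_coeff.simps) (auto simp: count_top_mset)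

text \<open>Rewriting strictly lowers the degree, and \<open>top_mset\<close> has degree exactly
  \<open>m * (q - 1)\<close>; so from this degree or below it is reached only by starting
  there.\<close>

lemma top_coeff_eq_0: "size a \<le> m * (q - 1) \<Longrightarrow> a \<noteq> top_mset \<Longrightarrow> top_coeff a = 0"
proof (induction "size a" arbitrary: a rule: less_induct)
  case less
  show ?case
  proof (cases "\<exists>j<m. q \<le> count a j")
    case True
    then have p: "pivot a < m" "q \<le> count a (pivot a)" using pivot by blast+
    have "top_coeff (a - replicate_mset q (pivot a) + b) = 0"
      if b: "b \<in> Poly_Mapping.keys (T (pivot a))" for b
    proof -
      have lt: "size (a - replicate_mset q (pivot a) + b) < size a"
        by (rule size_reduce[OF p(2) size_T[OF p(1) b]])
      then have "a - replicate_mset q (pivot a) + b \<noteq> top_mset"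
        using less.prems(1) size_top_mset by (metis leD)
      then show ?thesis
        using lt less.prems(1) by (intro less.hyps) linarith+
    qed
    then show ?thesis using True by (subst top_coeff.simps) (auto intro!: sum.neutral)
  next
    case False
    then show ?thesis using less by (subst top_coeff.simps) auto
  qed
qed

section \<open>Finite dimension modulo the rewriting relations\<close>

definition staircase :: "nat multiset set" where
  "staircase = {a. set_mset a \<subseteq> {..<m} \<and> (\<forall>j<m. count a j < q)}"

lemma finite_staircase: "finite staircase"
proof (rule finite_subset)
  show "staircase \<subseteq> (\<lambda>f. \<Sum>j<m. replicate_mset (f j) j) ` ({..<m} \<rightarrow>\<^sub>E {..<q})"
  proof
    fix a assume a: "a \<in> staircase"
    have "a = (\<Sum>j<m. replicate_mset (restrict (count a) {..<m} j) j)"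
      by (rule multiset_eqI)
         (use a in \<open>auto simp: count_sum staircase_def not_in_iff[symmetric] subset_iff\<close>)
    moreover have "restrict (count a) {..<m} \<in> {..<m} \<rightarrow>\<^sub>E {..<q}"
      using a by (auto simp: staircase_def)
    ultimately show "a \<in> (\<lambda>f. \<Sum>j<m. replicate_mset (f j) j) ` ({..<m} \<rightarrow>\<^sub>E {..<q})"
      by blast
  qed
qed (auto intro: finite_PiE)

text \<open>Replacing one q-th power changes the monomial by an element of
  \<open>annihilator\<close> and leaves only monomials of smaller degree.\<close>

lemma staircase_representative_single:
  assumes "set_mset a \<subseteq> {..<m}"
  shows "\<exists>s\<in>supported staircase. Poly_Mapping.single a c - s \<in> annihilator"
  using assms
proof (induction "size a" arbitrary: a c rule: less_induct)
  case less
  show ?case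
  proof (cases "a \<in> staircase")
    case True
    then show ?thesis
      by (intro bexI[of _ "Poly_Mapping.single a c"])
         (auto intro: supported_single ring_ideal_0[OF ring_ideal_annihilator])
  next
    case False
    then obtain j where j: "j < m" "q \<le> count a j"
      using less.prems by (auto simp: staircase_def not_less)
    then obtain a' where a: "a = a' + replicate_mset q j"
      by (metis count_le_replicate_mset_subset_eq subset_mset.diff_add)
    have "Poly_Mapping.single a' c * T j \<in> supported {b. set_mset b \<subseteq> {..<m} \<and> size b < size a}"
      by (rule supported_mult[OF _ T[OF j(1)], of _ "{a'}"])
         (use a less.prems in \<open>auto intro: supported_single\<close>)
    then have "\<exists>s\<in>supported staircase. Poly_Mapping.single a' c * T j - s \<in> annihilator"
    proof (induction rule: supported_induct)
      case zero
      then show ?case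
        by (intro bexI[of _ 0]) (auto intro: ring_ideal_0[OF ring_ideal_annihilator])
    next
      case (single b d)
      then show ?case using less.hyps by blast
    next
      case (add f g)
      then obtain s s' where "s \<in> supported staircase" "f - s \<in> annihilator"
        "s' \<in> supported staircase" "g - s' \<in> annihilator" by blast
      then show ?case
        using ring_ideal_add[OF ring_ideal_annihilator, of "f - s" "g - s'"]
        by (intro bexI[of _ "s + s'"]) (auto intro: supported_add simp: algebra_simps)
    qed
    then obtain s where s: "s \<in> supported staircase"
      "Poly_Mapping.single a' c * T j - s \<in> annihilator" by blast
    have "Poly_Mapping.single a' c * (ind j ^ q - T j) \<in> annihilator"
      by (rule ring_ideal_mult[OF ring_ideal_annihilator relation_in_annihilator[OF j(1)]])
    from ring_ideal_add[OF ring_ideal_annihilator this s(2)]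
    have "Poly_Mapping.single a c - s \<in> annihilator"
      by (simp add: algebra_simps ind_power mult_single a)
    then show ?thesis using s(1) by blast
  qed
qed

text \<open>Modulo \<open>annihilator\<close> the \<open>N + 1\<close> powers with exponents 0 to
  \<open>N\<close> lie in the span of the \<open>N\<close> staircase monomials, so they are linearly
  dependent.\<close>

lemma ind_algebraic:
  assumes "i < m"
  shows "\<exists>p. p \<noteq> 0 \<and> poly (map_poly cst p) (ind i) \<in> annihilator"
proof -
  have "\<exists>s. s \<in> supported staircase \<and> ind i ^ n - s \<in> annihilator" for n
  proof -
    have "set_mset (replicate_mset n i) \<subseteq> {..<m}" using assms by auto
    from staircase_representative_single[OF this, of 1] show ?thesis
      unfolding ind_power by blast
  qed
  then obtain s where s: "\<And>n. s n \<in> supported staircase"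
    "\<And>n. ind i ^ n - s n \<in> annihilator" by metis
  define N where "N = card staircase"
  obtain c where c: "\<exists>n\<in>{..N}. c n \<noteq> 0"
    "\<forall>t\<in>staircase. (\<Sum>n\<in>{..N}. c n * poly_mapping.lookup (s n) t) = 0"
    using exists_linear_relation[of "{..N}" staircase "\<lambda>n. poly_mapping.lookup (s n)"]
      finite_staircase by (auto simp: N_def)
  define p where "p = (\<Sum>n\<le>N. monom (c n) n)"
  have "coeff p n = c n" if "n \<le> N" for n
    using that by (simp add: p_def coeff_sum)
  then have "p \<noteq> 0" using c(1) by auto
  have eval: "poly (map_poly cst (\<Sum>n\<in>A. monom (c n) n)) x = (\<Sum>n\<in>A. cst (c n) * x ^ n)"
    if "finite A" for A x
    using that by (induction A) (auto simp: cst.poly_map_poly_add map_poly_monom poly_monom)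
  have "(\<Sum>n\<le>N. cst (c n) * s n) = 0"
  proof (rule poly_mapping_eqI)
    fix t
    have "cst b * f = Poly_Mapping.map ((*) b) f" for b f
      by (simp add: cst_def mult_map_scale_conv_mult)
    then have "poly_mapping.lookup (\<Sum>n\<le>N. cst (c n) * s n) t =
        (\<Sum>n\<le>N. c n * poly_mapping.lookup (s n) t)"
      by (auto simp: lookup_sum map.rep_eq when_def intro!: sum.cong)
    also have "\<dots> = 0"
    proof (cases "t \<in> staircase")
      case False
      then have "poly_mapping.lookup (s n) t = 0" for n
        using s(1)[of n] by (auto simp: supported_def in_keys_iff subset_iff)
      then show ?thesis by simp
    qed (use c in auto)
    finally show "poly_mapping.lookup (\<Sum>n\<le>N. cst (c n) * s n) t = poly_mapping.lookup 0 t"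
      by simp
  qed
  then have "poly (map_poly cst p) (ind i) = (\<Sum>n\<le>N. cst (c n) * (ind i ^ n - s n))"
    by (simp add: p_def eval right_diff_distrib sum_subtractf)
  also have "\<dots> \<in> annihilator"
    by (intro ring_ideal_sum ring_ideal_mult ring_ideal_annihilator s)
  finally show ?thesis using \<open>p \<noteq> 0\<close> by blast
qed

end

section \<open>Reflection-antisymmetric potentials\<close>

text \<open>For odd \<open>q\<close> the middle site carries 0. At indices \<open>i \<ge> q\<close>
  truncated subtraction gives \<open>- u 0\<close> (if \<open>q \<ge> 2\<close>), so the bounds on
  degree and order below hold at every index.\<close>

definition odd_potential :: "nat \<Rightarrow> (nat \<Rightarrow> 'a::ab_group_add) \<Rightarrow> nat \<Rightarrow> 'a" where
  "odd_potential q u i = (if i < q div 2 then u i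
     else if q - 1 - i < q div 2 then - u (q - 1 - i) else 0)"

lemma odd_potential_reflect:
  "i < q \<Longrightarrow> odd_potential q u (q - 1 - i) = - odd_potential q u i"
  by (auto simp: odd_potential_def)

text \<open>The difference of the Floquet determinants of \<open>v\<close> and of 0 as a polynomial
  in the spectral variable; the terms in \<open>z\<close> have cancelled.\<close>

definition spectral_diff :: "nat \<Rightarrow> (nat \<Rightarrow> 'a::comm_ring_1) \<Rightarrow> 'a poly" where
  "spectral_diff q v =
     periodic_continuant q (\<lambda>i. [:v i, - 1:]) - periodic_continuant q (\<lambda>i. [:0, - 1:])"

lemma poly_spectral_diff:
  "poly (spectral_diff q v) x =
     periodic_continuant q (\<lambda>i. v i - x) - periodic_continuant q (\<lambda>i. - x)"
  unfolding spectral_diff_def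
  by (simp add: periodic_continuant_hom[of "\<lambda>p. poly p x"])

lemma continuant_linear_coeffs:
  fixes v :: "nat \<Rightarrow> 'a::comm_ring_1"
  shows "degree (continuant (\<lambda>i. [:v i, - 1:]) n) \<le> n \<and>
    coeff (continuant (\<lambda>i. [:v i, - 1:]) n) n = (- 1) ^ n"
proof (induction "\<lambda>i. [:v i, - 1:]" n rule: continuant.induct)
  case (3 n)
  let ?K = "continuant (\<lambda>i. [:v i, - 1:])"
  have "degree ([:v (Suc n), - 1:] * ?K (Suc n)) \<le> Suc (Suc n)"
    using degree_mult_le[of "[:v (Suc n), - 1:]" "?K (Suc n)"] 3 by simp
  moreover have "coeff ([:v (Suc n), - 1:] * ?K (Suc n)) (Suc (Suc n)) = (- 1) ^ Suc (Suc n)"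
    using 3 by (simp add: coeff_eq_0)
  moreover have "coeff (?K n) (Suc (Suc n)) = 0"
    using 3 by (intro coeff_eq_0) auto
  ultimately show ?case
    using 3 by (simp add: degree_diff_le del: mult_pCons_left)
qed auto

lemma spectral_diff_coeff_high:
  assumes "q \<ge> 2" "n \<ge> q"
  shows "coeff (spectral_diff q v) n = 0"
proof -
  have "coeff (periodic_continuant q (\<lambda>i. [:w i, - 1:])) n = (if n = q then (- 1) ^ q else 0)"
    for w :: "nat \<Rightarrow> 'a"
  proof -
    have "coeff (continuant (\<lambda>i. [:w i, - 1:]) q) n = (if n = q then (- 1) ^ q else 0)"
      using continuant_linear_coeffs[of w q] assms by (auto intro: coeff_eq_0)
    moreover have "coeff (continuant (\<lambda>i. [:w (Suc i), - 1:]) (q - 2)) n = 0"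
      using continuant_linear_coeffs[of "\<lambda>i. w (Suc i)" "q - 2"] assms
      by (auto intro: coeff_eq_0)
    ultimately show ?thesis by (simp add: periodic_continuant_def)
  qed
  from this[of v] this[of "\<lambda>_. 0"] show ?thesis by (simp add: spectral_diff_def)
qed

text \<open>For an antisymmetric potential, reversing the sites and changing all signs turns the
  entries \<open>v i - lam\<close> into \<open>v i + lam\<close>. Reversal preserves the periodic
  continuant, the sign change multiplies it by \<open>(- 1) ^ q\<close>.\<close>

lemma spectral_diff_parity:
  assumes "q \<ge> 2" and refl: "\<And>i. i < q \<Longrightarrow> v (q - 1 - i) = - v i"
  shows "spectral_diff q v \<circ>\<^sub>p [:0, - 1:] = (- 1) ^ q * spectral_diff q v"
proof -
  have *: "periodic_continuant q (\<lambda>i. [:w i, - 1:]) \<circ>\<^sub>p [:0, - 1:] =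
      (- 1) ^ q * periodic_continuant q (\<lambda>i. [:w i, - 1:])"
    if "\<And>i. i < q \<Longrightarrow> w (q - 1 - i) = - w i" for w :: "nat \<Rightarrow> 'a"
  proof -
    have "periodic_continuant q (\<lambda>i. [:w i, - 1:]) \<circ>\<^sub>p [:0, - 1:] =
        periodic_continuant q (\<lambda>i. [:w i, - 1:] \<circ>\<^sub>p [:0, - 1:])"
      by (rule periodic_continuant_hom) (auto simp: pcompose_diff pcompose_mult one_pCons)
    also have "\<dots> = periodic_continuant q (\<lambda>i. - [:w (q - 1 - i), - 1:])"
      using that by (intro periodic_continuant_cong assms(1)) (simp add: pcompose_pCons)
    also have "\<dots> = (- 1) ^ q * periodic_continuant q (\<lambda>i. [:w (q - 1 - i), - 1:])"
      by (rule periodic_continuant_uminus) (rule assms(1))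
    also have "periodic_continuant q (\<lambda>i. [:w (q - 1 - i), - 1:]) =
        periodic_continuant q (\<lambda>i. [:w i, - 1:])"
      by (rule periodic_continuant_rev[of q "\<lambda>i. [:w i, - 1:]"]) (rule assms(1))
    finally show ?thesis .
  qed
  from *[of v] *[of "\<lambda>_. 0"] refl show ?thesis
    by (simp add: spectral_diff_def pcompose_diff right_diff_distrib)
qed

lemma spectral_diff_coeff_odd:
  fixes v :: "nat \<Rightarrow> mvpoly"
  assumes "q \<ge> 2" "\<And>i. i < q \<Longrightarrow> v (q - 1 - i) = - v i" "odd (q + n)"
  shows "coeff (spectral_diff q v) n = 0"
proof -
  let ?c = "coeff (spectral_diff q v) n"
  have "(- 1) ^ n * ?c = coeff (spectral_diff q v \<circ>\<^sub>p [:0, - 1:]) n"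
    by (simp add: coeff_pcompose_linear)
  also have "\<dots> = coeff ((- 1) ^ q * spectral_diff q v) n"
    by (subst spectral_diff_parity) (use assms in auto)
  also have "\<dots> = (- 1) ^ q * ?c"
    by (cases "even q") auto
  finally have "?c + ?c = 0"
    using assms(3) by (cases "even q") (auto simp: eq_neg_iff_add_eq_0 neg_eq_iff_add_eq_0)
  then have "cst (1/2) * (?c + ?c) = 0" by simp
  moreover have "cst (1/2) * (?c + ?c) = cst (1/2 + 1/2) * ?c"
    by (simp only: cst.hom_add distrib_left distrib_right)
  ultimately show ?thesis by simp
qed

text \<open>Parity and the degree bound leave only the exponents \<open>q - 2\<close>,
  \<open>q - 4\<close>, and so on: at most as many equations as free values of the
  potential.\<close>

lemma poly_spectral_diff_expand:
  fixes v :: "nat \<Rightarrow> mvpoly"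
  assumes "q \<ge> 2" "\<And>i. i < q \<Longrightarrow> v (q - 1 - i) = - v i"
  shows "poly (spectral_diff q v) x = (\<Sum>k<q div 2.
    x ^ (q - 2 * (k + 1)) * coeff (spectral_diff q v) (q - 2 * (k + 1)))"
proof -
  let ?p = "spectral_diff q v" and ?e = "\<lambda>k. q - 2 * (k + 1)"
  have deg: "degree ?p \<le> q"
    by (rule degree_le) (auto intro: spectral_diff_coeff_high[OF assms(1)])
  have "poly ?p x = (\<Sum>n\<le>degree ?p. coeff ?p n * x ^ n)"
    by (rule poly_altdef)
  also have "\<dots> = (\<Sum>n\<le>q. coeff ?p n * x ^ n)"
    using deg by (intro sum.mono_neutral_left) (auto simp: coeff_eq_0)
  also have "\<dots> = (\<Sum>n\<in>?e ` {..<q div 2}. coeff ?p n * x ^ n)"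
  proof (rule sum.mono_neutral_right)
    show "\<forall>n\<in>{..q} - ?e ` {..<q div 2}. coeff ?p n * x ^ n = 0"
    proof
      fix n assume n: "n \<in> {..q} - ?e ` {..<q div 2}"
      have "coeff ?p n = 0"
      proof (cases "even (q + n) \<and> n < q")
        case True
        then have "even (q - n)" by auto
        then obtain l where l: "q - n = 2 * l" by (elim evenE)
        then have "n = ?e (l - 1)" "l - 1 < q div 2" using True by auto
        then show ?thesis using n by blast
      next
        case False
        then show ?thesis
          using spectral_diff_coeff_high[of q n v] spectral_diff_coeff_odd[of q v n] assms by auto
      qed
      then show "coeff ?p n * x ^ n = 0" by simp
    qed
  qed auto
  also have "\<dots> = (\<Sum>k<q div 2. coeff ?p (?e k) * x ^ ?e k)"
    by (subst sum.reindex) (auto simp: inj_on_def)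
  finally show ?thesis by (simp add: mult.commute)
qed

section \<open>Filtrations by degree and by order of vanishing at 0\<close>

definition deg_le :: "nat \<Rightarrow> nat \<Rightarrow> mvpoly set" where
  "deg_le m d = supported {a. set_mset a \<subseteq> {..<m} \<and> size a \<le> d}"

definition ord_ge :: "nat \<Rightarrow> nat \<Rightarrow> mvpoly set" where
  "ord_ge m d = supported {a. set_mset a \<subseteq> {..<m} \<and> d \<le> size a}"

lemma deg_le_mult: "f \<in> deg_le m d \<Longrightarrow> g \<in> deg_le m e \<Longrightarrow> f * g \<in> deg_le m (d + e)"
  unfolding deg_le_def by (erule supported_mult) auto

lemma deg_le_mono: "f \<in> deg_le m d \<Longrightarrow> d \<le> e \<Longrightarrow> f \<in> deg_le m e"
  unfolding deg_le_def by (erule supported_mono) auto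

lemma deg_le_diff: "f \<in> deg_le m d \<Longrightarrow> g \<in> deg_le m d \<Longrightarrow> f - g \<in> deg_le m d"
  by (simp add: deg_le_def supported_diff)

lemma deg_le_uminus: "f \<in> deg_le m d \<Longrightarrow> - f \<in> deg_le m d"
  by (simp add: deg_le_def supported_uminus)

lemma deg_le_0: "0 \<in> deg_le m d"
  by (simp add: deg_le_def)

lemma deg_le_one: "1 \<in> deg_le m d"
  by (simp add: deg_le_def supported_def)

lemma deg_le_prod: "(\<And>i. i < n \<Longrightarrow> a i \<in> deg_le m 1) \<Longrightarrow> (\<Prod>i<n. a i) \<in> deg_le m n"
proof (induction n)
  case (Suc n)
  then show ?case using deg_le_mult[of "\<Prod>i<n. a i" m n "a n" 1] by simp
qed (simp add: deg_le_one)

lemma ind_deg_le: "i < m \<Longrightarrow> ind i \<in> deg_le m 1"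
  by (simp add: deg_le_def supported_def ind_def)

text \<open>Every term of a continuant other than the full product omits a pair of adjacent factors
  and so loses two degrees. Both bounds are proved together because the recursion uses both.\<close>

lemma continuant_top_degree:
  assumes "\<And>i. i < n \<Longrightarrow> a i \<in> deg_le m 1"
  shows "continuant a n - (\<Prod>i<n. a i) \<in> deg_le m (n - 2)"
    and "continuant a n \<in> deg_le m n"
proof -
  have "continuant a n - (\<Prod>i<n. a i) \<in> deg_le m (n - 2) \<and> continuant a n \<in> deg_le m n"
    using assms
  proof (induction a n rule: continuant.induct)
    case (3 a n)
    have "continuant a (Suc (Suc n)) - (\<Prod>i<Suc (Suc n). a i) =
        a (Suc n) * (continuant a (Suc n) - (\<Prod>i<Suc n. a i)) - continuant a n"
      by (simp add: algebra_simps)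
    also have "\<dots> \<in> deg_le m n"
    proof (cases n)
      \<comment> \<open>Here \<open>Suc n - 2\<close> truncates to 0 and the bound for the product
        would be one degree too weak; but the whole difference is just -1.\<close>
      case 0
      then show ?thesis using deg_le_uminus[OF deg_le_one, of m 0] by simp
    next
      case (Suc k)
      have "a (Suc n) * (continuant a (Suc n) - (\<Prod>i<Suc n. a i)) \<in> deg_le m (1 + (Suc n - 2))"
        using 3 by (intro deg_le_mult) auto
      then have "a (Suc n) * (continuant a (Suc n) - (\<Prod>i<Suc n. a i)) \<in> deg_le m n"
        by (rule deg_le_mono) (use Suc in auto)
      then show ?thesis using 3 by (intro deg_le_diff) auto
    qed
    finally have 1: "continuant a (Suc (Suc n)) - (\<Prod>i<Suc (Suc n). a i) \<in> deg_le m n" .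
    then have "continuant a (Suc (Suc n)) - (\<Prod>i<Suc (Suc n). a i) \<in> deg_le m (Suc (Suc n))"
      by (rule deg_le_mono) auto
    moreover have "(\<Prod>i<Suc (Suc n). a i) \<in> deg_le m (Suc (Suc n))"
      using 3 by (intro deg_le_prod) auto
    ultimately have "continuant a (Suc (Suc n)) \<in> deg_le m (Suc (Suc n))"
      unfolding deg_le_def by (metis supported_add diff_add_cancel)
    then show ?case using 1 by simp
  qed (auto simp: deg_le_one deg_le_0)
  then show "continuant a n - (\<Prod>i<n. a i) \<in> deg_le m (n - 2)"
    "continuant a n \<in> deg_le m n" by auto
qed

lemma periodic_continuant_top_degree:
  assumes "\<And>i. i < q \<Longrightarrow> a i \<in> deg_le m 1" "q \<ge> 2"
  shows "periodic_continuant q a - (\<Prod>i<q. a i) \<in> deg_le m (q - 2)"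
proof -
  have "continuant a q - (\<Prod>i<q. a i) - continuant (\<lambda>i. a (Suc i)) (q - 2) \<in> deg_le m (q - 2)"
    by (intro deg_le_diff continuant_top_degree) (use assms in auto)
  then show ?thesis by (simp add: periodic_continuant_def algebra_simps)
qed

lemma odd_potential_deg_le: "odd_potential q ind i \<in> deg_le (q div 2) 1"
  using ind_deg_le by (auto simp: odd_potential_def deg_le_def supported_uminus)

text \<open>At the spectral value \<open>ind j\<close> the product of all
  \<open>?v i - ind j\<close> vanishes through its factor at \<open>j\<close>. So the continuant of
  the potential loses its top form, and above degree \<open>q - 2\<close> only the power from the
  free one remains.\<close>

lemma spectral_diff_at_ind:
  assumes "q \<ge> 2" "j < q div 2"
  shows "ind j ^ q + (- 1) ^ q * poly (spectral_diff q (odd_potential q ind)) (ind j)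
    \<in> deg_le (q div 2) (q - 2)"
proof -
  let ?v = "odd_potential q ind" and ?D = "deg_le (q div 2) (q - 2)"
  have "(\<Prod>i<q. ?v i - ind j) = 0"
    by (rule prod_zero) (use assms in \<open>auto simp: odd_potential_def intro!: bexI[of _ j]\<close>)
  moreover have "periodic_continuant q (\<lambda>i. ?v i - ind j) - (\<Prod>i<q. ?v i - ind j) \<in> ?D"
    using odd_potential_deg_le ind_deg_le[OF assms(2)] assms(1)
    by (intro periodic_continuant_top_degree deg_le_diff)
  ultimately have 1: "periodic_continuant q (\<lambda>i. ?v i - ind j) \<in> ?D" by simp
  have 2: "periodic_continuant q (\<lambda>i. - ind j) - (\<Prod>i<q. - ind j) \<in> ?D"
    using ind_deg_le[OF assms(2)] assms(1)
    by (intro periodic_continuant_top_degree deg_le_uminus)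
  have "periodic_continuant q (\<lambda>i. ?v i - ind j) -
      (periodic_continuant q (\<lambda>i. - ind j) - (\<Prod>i<q. - ind j)) \<in> ?D" (is "?r \<in> _")
    using 1 2 by (rule deg_le_diff)
  then have "(- 1) ^ q * ?r \<in> ?D"
    using deg_le_uminus[of ?r "q div 2" "q - 2"] by (cases "even q") simp_all
  also have "(- 1) ^ q * ?r = ind j ^ q + (- 1) ^ q * poly (spectral_diff q ?v) (ind j)"
    by (cases "even q") (auto simp: poly_spectral_diff)
  finally show ?thesis .
qed

lemma ord_ge_mult: "f \<in> ord_ge m d \<Longrightarrow> g \<in> ord_ge m e \<Longrightarrow> f * g \<in> ord_ge m (d + e)"
  unfolding ord_ge_def by (erule supported_mult) auto

lemma ord_ge_mono: "f \<in> ord_ge m d \<Longrightarrow> e \<le> d \<Longrightarrow> f \<in> ord_ge m e"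
  unfolding ord_ge_def by (erule supported_mono) auto

lemma cst_ord_ge: "cst c \<in> ord_ge m 0"
  by (simp add: ord_ge_def supported_def cst_def)

lemma ord_ge_cst_mult: "f \<in> ord_ge m d \<Longrightarrow> cst c * f \<in> ord_ge m d"
  using ord_ge_mult[OF cst_ord_ge, of f m d c] by simp

lemma ord_ge_add: "f \<in> ord_ge m d \<Longrightarrow> g \<in> ord_ge m d \<Longrightarrow> f + g \<in> ord_ge m d"
  by (simp add: ord_ge_def supported_add)

lemma ord_ge_diff: "f \<in> ord_ge m d \<Longrightarrow> g \<in> ord_ge m d \<Longrightarrow> f - g \<in> ord_ge m d"
  by (simp add: ord_ge_def supported_diff)

lemma ord_ge_sum: "(\<And>i. i \<in> A \<Longrightarrow> f i \<in> ord_ge m d) \<Longrightarrow> sum f A \<in> ord_ge m d"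
  by (simp add: ord_ge_def supported_sum)

lemma ind_ord_ge: "i < m \<Longrightarrow> ind i \<in> ord_ge m 1"
  by (simp add: ord_ge_def supported_def ind_def)

lemma odd_potential_ord_ge: "odd_potential q ind i \<in> ord_ge (q div 2) 1"
  using ind_ord_ge by (auto simp: odd_potential_def ord_ge_def supported_uminus)

section \<open>Second order expansion at the double eigenvalues\<close>

text \<open>Discrete variation of constants. The sequence \<open>s\<close> consists of Chebyshev
  polynomials of the second kind: \<open>s (Suc n)\<close> is the continuant of the constant
  sequence \<open>c\<close>, and \<open>s (n - j)\<close> propagates the source at site
  \<open>j\<close>.\<close>

lemma continuant_perturbation:
  fixes s :: "nat \<Rightarrow> 'a::comm_ring_1"
  assumes s: "s 0 = 0" "s (Suc 0) = 1" "\<And>n. s (Suc (Suc n)) = c * s (Suc n) - s n"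
  shows "continuant (\<lambda>i. v i + c) n =
    s (Suc n) + (\<Sum>j<n. s (n - j) * v j * continuant (\<lambda>i. v i + c) j)"
proof (induction n rule: less_induct)
  case (less n)
  let ?K = "continuant (\<lambda>i. v i + c)"
  consider "n = 0" | "n = 1" | k where "n = Suc (Suc k)"
    by (metis One_nat_def not0_implies_Suc)
  then show ?case
  proof cases
    case 3
    have "?K n = v (Suc k) * ?K (Suc k) + c * ?K (Suc k) - ?K k"
      by (simp add: 3 algebra_simps)
    also have "c * ?K (Suc k) =
        c * (s (Suc (Suc k)) + (\<Sum>j<Suc k. s (Suc k - j) * v j * ?K j))"
      using less.IH[of "Suc k"] 3 by simp
    also have "?K k = s (Suc k) + (\<Sum>j<Suc k. s (k - j) * v j * ?K j)"
      using less.IH[of k] 3 s(1) by simp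
    also have "v (Suc k) * ?K (Suc k) + c * (s (Suc (Suc k)) + (\<Sum>j<Suc k. s (Suc k - j) * v j * ?K j))
        - (s (Suc k) + (\<Sum>j<Suc k. s (k - j) * v j * ?K j)) =
        s (Suc (Suc (Suc k))) + v (Suc k) * ?K (Suc k)
        + (\<Sum>j<Suc k. (c * s (Suc k - j) - s (k - j)) * v j * ?K j)"
      by (simp add: s(3)[of "Suc k"] sum_distrib_left sum_subtractf left_diff_distrib algebra_simps
          del: sum.lessThan_Suc)
    also have "(\<Sum>j<Suc k. (c * s (Suc k - j) - s (k - j)) * v j * ?K j) =
        (\<Sum>j<Suc k. s (n - j) * v j * ?K j)"
    proof (rule sum.cong)
      fix j assume "j \<in> {..<Suc k}"
      then have "n - j = Suc (Suc (k - j))" "Suc k - j = Suc (k - j)" using 3 by auto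
      then show "(c * s (Suc k - j) - s (k - j)) * v j * ?K j = s (n - j) * v j * ?K j"
        by (simp add: s(3))
    qed simp
    finally show ?thesis by (simp add: 3 s(2) algebra_simps)
  qed (simp_all add: s(2) s(3)[of 0] s(1) One_nat_def)
qed

text \<open>Addition formula for \<open>sin (n * t) / sin t\<close>, proved from the recursion
  alone: the left side is unchanged when one unit moves from \<open>a\<close> to
  \<open>b\<close>.\<close>

lemma recurrence_addition:
  fixes s :: "nat \<Rightarrow> 'a::comm_ring_1"
  assumes s: "s 0 = 0" "s (Suc 0) = 1" "\<And>n. s (Suc (Suc n)) = c * s (Suc n) - s n"
  shows "s (Suc b) * s (Suc a) - s b * s a = s (Suc (a + b))"
proof (induction a arbitrary: b)
  case (Suc a)
  have "s (Suc b) * s (Suc (Suc a)) - s b * s (Suc a) =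
      s (Suc (Suc b)) * s (Suc a) - s (Suc b) * s a"
    by (simp add: s(3) algebra_simps)
  also have "\<dots> = s (Suc (a + Suc b))" by (rule Suc)
  finally show ?case by simp
qed (simp add: s)

context
  fixes m :: nat and s :: "nat \<Rightarrow> mvpoly" and c :: mvpoly
  assumes s: "s 0 = 0" "s (Suc 0) = 1" "\<And>n. s (Suc (Suc n)) = c * s (Suc n) - s n"
    and s_ord: "\<And>n. s n \<in> ord_ge m 0"
begin

text \<open>The variation of constants formula is inserted into itself. Each insertion gains one
  factor from \<open>v\<close>, so the remainders have orders 1, 2 and finally 3.\<close>

lemma continuant_second_order:
  assumes v: "\<And>i. v i \<in> ord_ge m 1"
  shows "continuant (\<lambda>i. v i + c) n - (s (Suc n) + (\<Sum>j<n. s (n - j) * v j * s (Suc j))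
    + (\<Sum>j<n. \<Sum>i<j. s (n - j) * s (j - i) * s (Suc i) * (v i * v j))) \<in> ord_ge m 3"
proof -
  define K where "K = continuant (\<lambda>i. v i + c)"
  note K = continuant_perturbation[of s c v, OF s, folded K_def]
  have sv: "s k * v j \<in> ord_ge m 1" for k j
    using ord_ge_mult[OF s_ord v, of k j] by simp
  have 0: "K n \<in> ord_ge m 0" for n
  proof (induction n rule: less_induct)
    case (less n)
    have "s (n - j) * v j * K j \<in> ord_ge m 0" if "j < n" for j
      using ord_ge_mult[OF sv less[OF that]] by (rule ord_ge_mono) simp
    then show ?case
      by (subst K) (auto intro!: ord_ge_add ord_ge_sum s_ord)
  qed
  have 1: "K n - s (Suc n) \<in> ord_ge m 1" for n
  proof -
    have "K n - s (Suc n) = (\<Sum>j<n. s (n - j) * v j * K j)"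
      by (subst K) simp
    also have "\<dots> \<in> ord_ge m 1"
      using ord_ge_mult[OF sv 0] by (intro ord_ge_sum) simp
    finally show ?thesis .
  qed
  have 2: "K n - (s (Suc n) + (\<Sum>j<n. s (n - j) * v j * s (Suc j))) \<in> ord_ge m 2" for n
  proof -
    have "K n - (s (Suc n) + (\<Sum>j<n. s (n - j) * v j * s (Suc j))) =
        (\<Sum>j<n. s (n - j) * v j * (K j - s (Suc j)))"
      by (subst K) (simp add: right_diff_distrib sum_subtractf)
    also have "\<dots> \<in> ord_ge m 2"
      using ord_ge_mult[OF sv 1] by (intro ord_ge_sum) (simp add: numeral_2_eq_2)
    finally show ?thesis .
  qed
  have "K n - (s (Suc n) + (\<Sum>j<n. s (n - j) * v j * s (Suc j))
      + (\<Sum>j<n. \<Sum>i<j. s (n - j) * s (j - i) * s (Suc i) * (v i * v j))) =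
      (\<Sum>j<n. s (n - j) * v j * (K j - (s (Suc j) + (\<Sum>i<j. s (j - i) * v i * s (Suc i)))))"
    by (subst K) (simp add: right_diff_distrib distrib_left sum_subtractf sum.distrib
        sum_distrib_left mult_ac)
  also have "\<dots> \<in> ord_ge m 3"
    using ord_ge_mult[OF sv 2] by (intro ord_ge_sum) (simp add: numeral_3_eq_3 numeral_2_eq_2)
  finally show ?thesis unfolding K_def .
qed

text \<open>The continuants of all sites and of the interior are expanded separately. The addition
  formula merges them, so that the second order coefficient depends on the distance
  \<open>j - i\<close> only.\<close>

lemma periodic_continuant_second_order:
  assumes v: "\<And>i. v i \<in> ord_ge m 1" and q: "q \<ge> 2"
  shows "periodic_continuant q (\<lambda>i. v i + c) - (s (Suc q) - s (q - 1)
    + s q * (\<Sum>j<q. v j)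
    + (\<Sum>j<q. \<Sum>i<j. s (j - i) * s (q - (j - i)) * (v i * v j))) \<in> ord_ge m 3"
proof -
  obtain k where k: "q = Suc (Suc k)" using q by (metis add_2_eq_Suc le_Suc_ex)
  \<comment> \<open>The terms at the two end sites vanish because of \<open>s 0 = 0\<close>, so sums
    over the interior may run over all sites.\<close>
  have shift: "(\<Sum>j<k. f (Suc j)) = (\<Sum>j<q. f j)" if "f 0 = 0" "f (Suc k) = 0"
    for f :: "nat \<Rightarrow> mvpoly"
  proof -
    have "(\<Sum>j<q. f j) = (\<Sum>j<Suc k. f j)" using that k by simp
    also have "\<dots> = (\<Sum>j<k. f (Suc j))" using that by (subst sum.lessThan_Suc_shift) simp
    finally show ?thesis ..
  qed
  define E where "E = s (Suc q) + (\<Sum>j<q. s (q - j) * v j * s (Suc j))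
    + (\<Sum>j<q. \<Sum>i<j. s (q - j) * s (j - i) * s (Suc i) * (v i * v j))"
  define E' where "E' = s (q - 1) + (\<Sum>j<q. s (q - 1 - j) * v j * s j)
    + (\<Sum>j<q. \<Sum>i<j. s (q - 1 - j) * s (j - i) * s i * (v i * v j))"
  have "continuant (\<lambda>i. v i + c) q - E \<in> ord_ge m 3"
    unfolding E_def by (rule continuant_second_order[OF v])
  moreover have "continuant (\<lambda>i. v (Suc i) + c) k - E' \<in> ord_ge m 3"
  proof -
    have "(\<Sum>j<k. s (k - j) * v (Suc j) * s (Suc j)) = (\<Sum>j<q. s (q - 1 - j) * v j * s j)"
      using shift[of "\<lambda>j. s (q - 1 - j) * v j * s j"] by (simp add: s(1) k)
    moreover have "(\<Sum>j<k. \<Sum>i<j. s (k - j) * s (j - i) * s (Suc i) * (v (Suc i) * v (Suc j))) =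
        (\<Sum>j<q. \<Sum>i<j. s (q - 1 - j) * s (j - i) * s i * (v i * v j))"
      using shift[of "\<lambda>j. \<Sum>i<j. s (q - 1 - j) * s (j - i) * s i * (v i * v j)"]
      by (simp add: s(1) k sum.lessThan_Suc_shift del: sum.lessThan_Suc)
    ultimately show ?thesis
      using continuant_second_order[where v = "\<lambda>i. v (Suc i)" and n = k, OF v]
      by (simp add: E'_def k)
  qed
  ultimately have "continuant (\<lambda>i. v i + c) q - E - (continuant (\<lambda>i. v (Suc i) + c) k - E')
      \<in> ord_ge m 3"
    by (rule ord_ge_diff)
  moreover have E: "E - E' = s (Suc q) - s (q - 1) + s q * (\<Sum>j<q. v j)
    + (\<Sum>j<q. \<Sum>i<j. s (j - i) * s (q - (j - i)) * (v i * v j))"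
  proof -
    have add: "s (q - j) * s (Suc i) - s (q - 1 - j) * s i = s (q - (j - i))"
      if "i \<le> j" "j < q" for i j
    proof -
      have "Suc (i + (q - 1 - j)) = q - (j - i)" "Suc (q - 1 - j) = q - j" using that by auto
      then show ?thesis using recurrence_addition[of s c "q - 1 - j" i, OF s] by simp
    qed
    have 1: "(\<Sum>j<q. s (q - j) * v j * s (Suc j)) - (\<Sum>j<q. s (q - 1 - j) * v j * s j) =
        s q * (\<Sum>j<q. v j)"
    proof -
      have "(\<Sum>j<q. s (q - j) * v j * s (Suc j)) - (\<Sum>j<q. s (q - 1 - j) * v j * s j) =
          (\<Sum>j<q. (s (q - j) * s (Suc j) - s (q - 1 - j) * s j) * v j)"
        by (simp add: sum_subtractf left_diff_distrib right_diff_distrib mult_ac)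
      also have "\<dots> = (\<Sum>j<q. s q * v j)"
        by (intro sum.cong refl) (use add in fastforce)
      finally show ?thesis by (simp add: sum_distrib_left)
    qed
    have 2: "(\<Sum>j<q. \<Sum>i<j. s (q - j) * s (j - i) * s (Suc i) * (v i * v j)) -
        (\<Sum>j<q. \<Sum>i<j. s (q - 1 - j) * s (j - i) * s i * (v i * v j)) =
        (\<Sum>j<q. \<Sum>i<j. s (j - i) * s (q - (j - i)) * (v i * v j))"
    proof -
      have "(\<Sum>j<q. \<Sum>i<j. s (q - j) * s (j - i) * s (Suc i) * (v i * v j)) -
          (\<Sum>j<q. \<Sum>i<j. s (q - 1 - j) * s (j - i) * s i * (v i * v j)) =
          (\<Sum>j<q. \<Sum>i<j. s (j - i) *
            (s (q - j) * s (Suc i) - s (q - 1 - j) * s i) * (v i * v j))"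
        by (simp add: sum_subtractf left_diff_distrib right_diff_distrib mult_ac)
      also have "\<dots> = (\<Sum>j<q. \<Sum>i<j. s (j - i) * s (q - (j - i)) * (v i * v j))"
        by (intro sum.cong refl) (simp only: lessThan_iff add[OF less_imp_le])
      finally show ?thesis .
    qed
    show ?thesis
      unfolding 1[symmetric] 2[symmetric] E_def E'_def by (simp add: algebra_simps)
  qed
  moreover have "periodic_continuant q (\<lambda>i. v i + c) - (E - E') =
      continuant (\<lambda>i. v i + c) q - E - (continuant (\<lambda>i. v (Suc i) + c) k - E')"
    by (simp add: periodic_continuant_def k del: continuant.simps)
  ultimately show ?thesis unfolding E by simp
qed

end

lemma sum_symmetric:
  fixes f :: "nat \<Rightarrow> nat \<Rightarrow> 'a::comm_ring_1"
  assumes "\<And>i j. f i j = f j i" "\<And>i. f i i = 0"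
  shows "(\<Sum>j<n. \<Sum>i<n. f i j) = 2 * (\<Sum>j<n. \<Sum>i<j. f i j)"
proof (induction n)
  case (Suc n)
  have "(\<Sum>j<Suc n. \<Sum>i<Suc n. f i j) =
      (\<Sum>j<n. \<Sum>i<n. f i j) + (\<Sum>j<n. f n j) + (\<Sum>i<n. f i n)"
    by (simp add: sum.distrib assms(2))
  also have "(\<Sum>j<n. f n j) = (\<Sum>i<n. f i n)"
    by (simp add: assms(1)[of n])
  finally show ?case using Suc by (simp add: algebra_simps)
qed simp

lemma cst_scale_eq_0:
  assumes "c \<noteq> 0" "cst c * f = 0"
  shows "f = 0"
proof -
  have "cst (inverse c) * (cst c * f) = (cst c * cst (inverse c)) * f"
    by (simp only: mult_ac)
  then show ?thesis using assms(2) by (simp add: cst_inverse[OF assms(1)])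
qed

section \<open>Discrete Fourier coefficients of antisymmetric potentials\<close>

definition fourier :: "nat \<Rightarrow> (nat \<Rightarrow> mvpoly) \<Rightarrow> nat \<Rightarrow> mvpoly" where
  "fourier q v k = (\<Sum>j<q. cst (cis (2 * pi / q) ^ (k * j)) * v j)"

context
  fixes q :: nat and v :: "nat \<Rightarrow> mvpoly"
  assumes q: "q > 0" and reflect: "\<And>i. i < q \<Longrightarrow> v (q - 1 - i) = - v i"
begin

lemma root_power_q: "cis (2 * pi / q) ^ q = 1"
  using q by (simp add: DeMoivre)

lemma root_power_neq_1: "0 < d \<Longrightarrow> d < q \<Longrightarrow> cis (2 * pi / q) ^ d \<noteq> 1"
proof
  assume d: "0 < d" "d < q" and "cis (2 * pi / q) ^ d = 1"
  then have "cis (2 * pi * real d / real q) = cis (2 * pi * real 0 / real q)"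
    by (simp add: DeMoivre mult.commute)
  then have "d = 0"
    by (rule inj_onD[OF bij_betw_imp_inj_on[OF bij_betw_roots_unity[OF q]]]) (use d in auto)
  then show False using d by simp
qed

text \<open>The left side is the Fourier coefficient at the frequency \<open>- k\<close>; reflecting
  the sites turns it into the one at \<open>k\<close>, up to sign and phase.\<close>

lemma fourier_conjugate:
  "(\<Sum>i<q. cst (cis (2 * pi / q) ^ (k * (q - i))) * v i) = - cst (cis (2 * pi / q) ^ k) * fourier q v k"
proof -
  let ?w = "cis (2 * pi / q)"
  have "(\<Sum>i<q. cst (?w ^ (k * (q - i))) * v i) =
      (\<Sum>j<q. cst (?w ^ (k * (q - (q - Suc j)))) * v (q - Suc j))"
    by (rule sum.nat_diff_reindex[symmetric])
  also have "\<dots> = (\<Sum>j<q. - cst (?w ^ k) * (cst (?w ^ (k * j)) * v j))"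
  proof (rule sum.cong)
    fix j assume "j \<in> {..<q}"
    then have "q - (q - Suc j) = Suc j" "v (q - Suc j) = - v j" using reflect[of j] by auto
    then show "cst (?w ^ (k * (q - (q - Suc j)))) * v (q - Suc j) =
        - cst (?w ^ k) * (cst (?w ^ (k * j)) * v j)"
      by (simp add: power_add cst.hom_mult mult_ac)
  qed simp
  finally show ?thesis by (simp add: fourier_def sum_distrib_left)
qed

lemma fourier_0: "fourier q v 0 = 0"
proof -
  have "fourier q v 0 = - fourier q v 0"
    using fourier_conjugate[of 0] by (simp add: fourier_def)
  then have "cst 2 * fourier q v 0 = 0"
    by (metis cst.hom_add cst.hom_one distrib_right mult_1_left one_add_one add.right_inverse)
  then show ?thesis by (rule cst_scale_eq_0[rotated]) simp
qed

lemma fourier_reflect: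
  assumes "k \<le> q"
  shows "fourier q v (q - k) = - cst (cis (2 * pi / q) ^ k) * fourier q v k"
proof -
  let ?w = "cis (2 * pi / q)"
  have "?w ^ ((q - k) * j) = ?w ^ (k * (q - j))" if "j < q" for j
  proof -
    have "(q - k) * j + q * k = k * (q - j) + q * j"
      using assms that by (simp add: diff_mult_distrib diff_mult_distrib2 algebra_simps)
    then have "?w ^ ((q - k) * j) * (?w ^ q) ^ k = ?w ^ (k * (q - j)) * (?w ^ q) ^ j"
      by (metis power_add power_mult)
    then show ?thesis by (simp add: root_power_q)
  qed
  then have "fourier q v (q - k) = (\<Sum>i<q. cst (?w ^ (k * (q - i))) * v i)"
    by (simp add: fourier_def)
  then show ?thesis by (simp add: fourier_conjugate)
qed

lemma fourier_inversion:
  assumes "j < q"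
  shows "v j = cst (1 / of_nat q) * (\<Sum>k<q. cst (cis (2 * pi / q) ^ (k * (q - j))) * fourier q v k)"
proof -
  let ?w = "cis (2 * pi / q)"
  have geom: "(\<Sum>k<q. ?w ^ (k * (q - j)) * ?w ^ (k * n)) = (if n = j then of_nat q else 0)"
    if "n < q" for n
  proof -
    define z where "z = ?w ^ (q - j + n)"
    have "(\<Sum>k<q. ?w ^ (k * (q - j)) * ?w ^ (k * n)) = (\<Sum>k<q. z ^ k)"
    proof (rule sum.cong)
      fix k
      have "k * (q - j) + k * n = (q - j + n) * k"
        by (simp only: distrib_left[symmetric] mult.commute)
      then show "?w ^ (k * (q - j)) * ?w ^ (k * n) = z ^ k"
        by (simp only: z_def power_add[symmetric] power_mult[symmetric])
    qed simp
    also have "\<dots> = (if n = j then of_nat q else 0)"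
    proof (cases "n = j")
      case True
      then have "z = 1" using assms root_power_q by (simp add: z_def)
      then show ?thesis using True by simp
    next
      case False
      have "z \<noteq> 1"
      proof (cases "n < j")
        case True
        then show ?thesis using assms unfolding z_def by (intro root_power_neq_1) auto
      next
        case 1: False
        then have "q - j + n = q + (n - j)" using assms by auto
        then have "z = ?w ^ (n - j)" by (simp add: z_def power_add root_power_q)
        then show ?thesis using root_power_neq_1[of "n - j"] 1 False that by auto
      qed
      moreover have "z ^ q = 1"
        unfolding z_def by (metis power_mult mult.commute root_power_q power_one)
      ultimately show ?thesis using False by (simp add: geometric_sum)
    qed
    finally show ?thesis .
  qed
  have "(\<Sum>k<q. cst (?w ^ (k * (q - j))) * fourier q v k) =
      (\<Sum>n<q. cst (\<Sum>k<q. ?w ^ (k * (q - j)) * ?w ^ (k * n)) * v n)"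
    unfolding fourier_def sum_distrib_left cst.hom_sum sum_distrib_right
    by (subst sum.swap) (simp add: cst.hom_mult mult_ac)
  also have "\<dots> = (\<Sum>n<q. if n = j then cst (of_nat q) * v n else 0)"
    by (rule sum.cong) (simp_all only: geom lessThan_iff if_distrib cst.hom_zero mult_zero_left, auto)
  also have "\<dots> = cst (of_nat q) * v j"
    using assms by simp
  finally have "cst (1 / of_nat q) * (\<Sum>k<q. cst (?w ^ (k * (q - j))) * fourier q v k) =
      cst (1 / of_nat q * of_nat q) * v j"
    by (simp only: cst.hom_mult mult.assoc)
  then show ?thesis using q by simp
qed

text \<open>Twice the sum is the full double sum. By
  \<open>4 * (sin x)^2 = 2 - cis (2 * x) - cis (- 2 * x)\<close> it splits into a constant part,
  which vanishes with the sum of \<open>v\<close>, and two equal products of the coefficients at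
  \<open>k\<close> and \<open>- k\<close>, which antisymmetry makes a multiple of the
  square.\<close>

lemma fourier_square:
  assumes "0 < k" "k < q"
  shows "(\<Sum>j<q. \<Sum>i<j. cst (of_real ((sin ((real j - real i) * (pi * k / q)))\<^sup>2)) * (v i * v j)) =
    cst (cis (2 * pi / q) ^ k / 4) * (fourier q v k)\<^sup>2"
proof -
  let ?w = "cis (2 * pi / q)" and ?t = "pi * k / q"
  let ?e = "\<lambda>i j. ?w ^ (k * j) * ?w ^ (k * (q - i))"
  let ?S = "\<lambda>i j. complex_of_real ((sin ((real j - real i) * ?t))\<^sup>2)"
  define D where "D = (\<Sum>j<q. \<Sum>i<q. cst (?S i j) * (v i * v j))"
  have e: "?e i j = cis (2 * ((real j - real i) * ?t))" if "i < q" for i j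
  proof -
    have "?w ^ (k * (q - i)) = cis (real k * 2 * pi) * cis (- (2 * real i * ?t))"
      using that q by (simp add: DeMoivre cis_mult of_nat_diff field_simps)
    also have "cis (real k * 2 * pi) = 1"
      by (metis DeMoivre cis_2pi power_one mult.assoc)
    finally show ?thesis
      using q by (simp add: DeMoivre cis_mult field_simps)
  qed
  have S: "4 * ?S i j = 2 - ?e i j - ?e j i" if "i < q" "j < q" for i j
  proof -
    have "cis (2 * x) + cis (2 * (- x)) = 2 - 4 * of_real ((sin x)\<^sup>2)" for x
      by (rule complex_eqI) (simp_all add: cos_double_sin sin_minus)
    note double = this
    define x where "x = (real j - real i) * ?t"
    have 1: "?e i j = cis (2 * x)" unfolding x_def by (rule e[OF that(1)])
    have "(real i - real j) * ?t = - x" by (simp only: x_def mult_minus_left[symmetric] minus_diff_eq)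
    with e[OF that(2), of i] have 2: "?e j i = cis (2 * (- x))" by (simp only:)
    show ?thesis
      unfolding 1 2 x_def[symmetric] using double[of x] by (simp add: algebra_simps)
  qed
  have hh: "(\<Sum>j<q. \<Sum>i<q. cst (?e i j) * (v i * v j)) =
      fourier q v k * (\<Sum>i<q. cst (?w ^ (k * (q - i))) * v i)"
  proof -
    have "(\<Sum>j<q. \<Sum>i<q. cst (?e i j) * (v i * v j)) =
        (\<Sum>j<q. \<Sum>i<q. (cst (?w ^ (k * j)) * v j) * (cst (?w ^ (k * (q - i))) * v i))"
      by (intro sum.cong refl) (simp only: cst.hom_mult mult_ac)
    then show ?thesis by (simp only: sum_product fourier_def)
  qed
  have hh': "(\<Sum>j<q. \<Sum>i<q. cst (?e j i) * (v i * v j)) =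
      fourier q v k * (\<Sum>i<q. cst (?w ^ (k * (q - i))) * v i)"
    unfolding hh[symmetric] by (subst sum.swap) (intro sum.cong refl arg_cong2[where f = "(*)"] mult.commute)
  have sum0: "(\<Sum>j<q. \<Sum>i<q. v i * v j) = 0"
  proof -
    have "(\<Sum>j<q. v j) = 0" using fourier_0 by (simp add: fourier_def)
    then have "(\<Sum>j<q. v j) * (\<Sum>i<q. v i) = 0" by simp
    then show ?thesis by (subst sum.swap) (simp only: sum_product)
  qed
  have "cst 4 * D = (\<Sum>j<q. \<Sum>i<q. cst (4 * ?S i j) * (v i * v j))"
    by (simp only: D_def sum_distrib_left cst.hom_mult mult.assoc)
  also have "\<dots> = (\<Sum>j<q. \<Sum>i<q. cst (2 - ?e i j - ?e j i) * (v i * v j))"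
    by (intro sum.cong refl) (simp only: S lessThan_iff)
  also have "\<dots> = cst 2 * (\<Sum>j<q. \<Sum>i<q. v i * v j) - (\<Sum>j<q. \<Sum>i<q. cst (?e i j) * (v i * v j))
      - (\<Sum>j<q. \<Sum>i<q. cst (?e j i) * (v i * v j))"
    by (simp only: cst.hom_minus left_diff_distrib sum_subtractf sum_distrib_left)
  also have "\<dots> = cst (2 * ?w ^ k) * (fourier q v k)\<^sup>2"
  proof -
    have two: "cst 2 = 1 + 1" by (metis cst.hom_add cst.hom_one one_add_one)
    have "cst 2 * 0 - F * (- W * F) - F * (- W * F) = cst 2 * W * F\<^sup>2" for F W
      unfolding two power2_eq_square by (simp add: algebra_simps)
    then show ?thesis
      unfolding hh hh' sum0 fourier_conjugate cst.hom_mult[of 2] .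
  qed
  finally have D: "cst 4 * D = cst (2 * ?w ^ k) * (fourier q v k)\<^sup>2" .
  have "D = 2 * (\<Sum>j<q. \<Sum>i<j. cst (?S i j) * (v i * v j))"
    unfolding D_def
  proof (rule sum_symmetric)
    fix i j
    have "(real j - real i) * ?t = - ((real i - real j) * ?t)"
      by (simp only: mult_minus_left[symmetric] minus_diff_eq)
    then have "?S i j = ?S j i" by (simp only: sin_minus power2_minus)
    then show "cst (?S i j) * (v i * v j) = cst (?S j i) * (v j * v i)" by (simp add: mult_ac)
  qed simp
  also have "(2 :: mvpoly) = cst 2"
    by (metis cst.hom_add cst.hom_one one_add_one)
  finally have "cst (1/2) * D = cst (1/2 * 2) * (\<Sum>j<q. \<Sum>i<j. cst (?S i j) * (v i * v j))"
    by (simp only: cst.hom_mult mult.assoc)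
  then have "(\<Sum>j<q. \<Sum>i<j. cst (?S i j) * (v i * v j)) = cst (1/2) * D"
    by simp
  also have "D = cst (1/4 * 4) * D" by simp
  also have "\<dots> = cst (1/4) * (cst (2 * ?w ^ k) * (fourier q v k)\<^sup>2)"
    by (simp only: cst.hom_mult D mult.assoc)
  also have "cst (1/2) * \<dots> = cst (1/2 * (1/4 * (2 * ?w ^ k))) * (fourier q v k)\<^sup>2"
    by (simp only: cst.hom_mult mult.assoc)
  finally show ?thesis by simp
qed

text \<open>The spectral value is \<open>- 2 * cos (pi * k / q)\<close>. There
  \<open>s q = 0\<close> removes the linear term, and the quadratic form has coefficients
  proportional to squared sines, so it is a nonzero multiple of the square of one Fourier
  coefficient.\<close>

lemma spectral_diff_second_order:
  assumes k: "0 < k" "k < q" and v: "\<And>i. v i \<in> ord_ge m 1"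
  shows "\<exists>c x. (fourier q v k)\<^sup>2 - cst c * poly (spectral_diff q v) x \<in> ord_ge m 3"
proof -
  define t where "t = pi * k / q"
  have t: "0 < t" "t < pi" "real q * t = real k * pi"
    using k by (auto simp: t_def field_simps)
  have sin_t: "sin t \<noteq> 0" using sin_gt_zero[OF t(1,2)] by simp
  define S where "S n = sin (real n * t) / sin t" for n
  define s where "s n = cst (of_real (S n))" for n
  define c where "c = cst (of_real (2 * cos t))"
  have "S (Suc (Suc n)) = 2 * cos t * S (Suc n) - S n" for n
  proof -
    have "sin (real n * t + t + t) + sin (real n * t + t - t) = 2 * cos t * sin (real n * t + t)"
      unfolding sin_add[of "real n * t + t" t] sin_diff by simp
    then show ?thesis
      using sin_t by (simp add: S_def field_simps)
  qed
  then have s: "s 0 = 0" "s (Suc 0) = 1" "\<And>n. s (Suc (Suc n)) = c * s (Suc n) - s n"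
    using sin_t
    by (simp_all add: s_def c_def S_def[of 0] S_def[of "Suc 0"] cst.hom_mult cst.hom_minus)
  have s_ord: "s n \<in> ord_ge m 0" for n
    unfolding s_def by (rule cst_ord_ge)
  \<comment> \<open>The sign comes from \<open>sin (k * pi - y) = - ((- 1) ^ k) * sin y\<close>, the
    denominator from the two factors \<open>s\<close>.\<close>
  define K where "K = - ((- 1) ^ k) / (sin t)\<^sup>2"
  have K: "K \<noteq> 0" using sin_t by (simp add: K_def)
  have "q \<ge> 2" using k by auto
  define Q where "Q = (\<Sum>j<q. \<Sum>i<j. s (j - i) * s (q - (j - i)) * (v i * v j))"
  have sq: "s q = 0" by (simp add: s_def S_def t)
  have "periodic_continuant q (\<lambda>i. v i + c) - (s (Suc q) - s (q - 1) + s q * (\<Sum>j<q. v j) + Q)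
      \<in> ord_ge m 3"
    unfolding Q_def
    by (rule periodic_continuant_second_order[where c = c and s = s]) (use s s_ord v \<open>q \<ge> 2\<close> in auto)
  \<comment> \<open>The expansion at the zero potential has the same constant part, which cancels in
    the difference.\<close>
  moreover have "periodic_continuant q (\<lambda>i. 0 + c) - (s (Suc q) - s (q - 1) + s q * (\<Sum>j<q. 0)
      + (\<Sum>j<q. \<Sum>i<j. s (j - i) * s (q - (j - i)) * (0 * 0))) \<in> ord_ge m 3"
    by (rule periodic_continuant_second_order[where c = c and s = s and v = "\<lambda>_. 0"])
       (use s s_ord \<open>q \<ge> 2\<close> in \<open>auto simp: ord_ge_def\<close>)
  ultimately have "periodic_continuant q (\<lambda>i. v i + c) - (s (Suc q) - s (q - 1) + s q * (\<Sum>j<q. v j) + Q)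
      - (periodic_continuant q (\<lambda>i. 0 + c) - (s (Suc q) - s (q - 1) + s q * (\<Sum>j<q. 0)
      + (\<Sum>j<q. \<Sum>i<j. s (j - i) * s (q - (j - i)) * (0 * 0)))) \<in> ord_ge m 3"
    by (rule ord_ge_diff)
  then have 1: "poly (spectral_diff q v) (- c) - Q \<in> ord_ge m 3"
    by (simp add: sq poly_spectral_diff algebra_simps)
  have "s (j - i) * s (q - (j - i)) = cst (of_real K) *
      cst (of_real ((sin ((real j - real i) * (pi * k / q)))\<^sup>2))" if "i < j" "j < q" for i j
  proof -
    define y where "y = (real j - real i) * t"
    have "real (q - (j - i)) * t = real k * pi - y"
      using that t(3) by (simp add: y_def of_nat_diff algebra_simps)
    moreover have "real (j - i) * t = y" using that by (simp add: y_def of_nat_diff)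
    ultimately have "S (j - i) * S (q - (j - i)) = K * (sin y)\<^sup>2"
      using sin_t by (simp add: S_def K_def sin_diff power2_eq_square)
    from arg_cong[OF this, of "\<lambda>x. cst (of_real x)"] show ?thesis
      by (simp only: s_def y_def t_def of_real_mult cst.hom_mult)
  qed
  then have "Q = cst (of_real K) * (\<Sum>j<q. \<Sum>i<j.
      cst (of_real ((sin ((real j - real i) * (pi * k / q)))\<^sup>2)) * (v i * v j))"
    by (simp add: Q_def sum_distrib_left mult.assoc)
  also have "\<dots> = cst (of_real K * (cis (2 * pi / q) ^ k / 4)) * (fourier q v k)\<^sup>2"
    by (simp only: fourier_square[OF k] cst.hom_mult mult.assoc)
  finally have Q: "Q = cst (of_real K * (cis (2 * pi / q) ^ k / 4)) * (fourier q v k)\<^sup>2" .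
  define b where "b = of_real K * (cis (2 * pi / q) ^ k / 4)"
  have "b \<noteq> 0" using K by (simp add: b_def)
  have "cst (- inverse b) * (poly (spectral_diff q v) (- c) - Q) \<in> ord_ge m 3"
    by (rule ord_ge_cst_mult[OF 1])
  also have "cst (- inverse b) * (poly (spectral_diff q v) (- c) - Q) =
      cst b * cst (inverse b) * (fourier q v k)\<^sup>2 - cst (inverse b) * poly (spectral_diff q v) (- c)"
    unfolding Q b_def[symmetric] by (simp add: cst.hom_uminus algebra_simps)
  also have "cst b * cst (inverse b) = 1"
    by (rule cst_inverse) fact
  finally show ?thesis by auto
qed

lemma fourier_ord_ge: "(\<And>i. v i \<in> ord_ge m 1) \<Longrightarrow> fourier q v k \<in> ord_ge m 1"
  unfolding fourier_def by (intro ord_ge_sum ord_ge_cst_mult)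

text \<open>In the inversion formula the coefficient at 0 vanishes, and reflection reduces each
  frequency above \<open>q div 2\<close> to one that is at most \<open>q div 2\<close>.\<close>

lemma fourier_half_span:
  assumes "j < q"
  shows "\<exists>c. v j = (\<Sum>k\<in>{1..q div 2}. cst (c k) * fourier q v k)"
proof -
  let ?w = "cis (2 * pi / q)"
  define L where "L = {f. \<exists>c. f = (\<Sum>k\<in>{1..q div 2}. cst (c k) * fourier q v k)}"
  have L0: "0 \<in> L"
    unfolding L_def by (intro CollectI exI[of _ "\<lambda>_. 0"]) simp
  have L_add: "f + g \<in> L" if f: "f \<in> L" and g: "g \<in> L" for f g
  proof -
    obtain c where "f = (\<Sum>k\<in>{1..q div 2}. cst (c k) * fourier q v k)"
      using f unfolding L_def by blast
    moreover obtain d where "g = (\<Sum>k\<in>{1..q div 2}. cst (d k) * fourier q v k)"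
      using g unfolding L_def by blast
    ultimately have "f + g = (\<Sum>k\<in>{1..q div 2}. cst (c k + d k) * fourier q v k)"
      by (simp add: cst.hom_add distrib_right sum.distrib)
    then show ?thesis unfolding L_def by (intro CollectI exI[of _ "\<lambda>k. c k + d k"])
  qed
  have L_cst: "cst b * f \<in> L" if f: "f \<in> L" for b f
  proof -
    obtain c where "f = (\<Sum>k\<in>{1..q div 2}. cst (c k) * fourier q v k)"
      using f unfolding L_def by blast
    then have "cst b * f = (\<Sum>k\<in>{1..q div 2}. cst (b * c k) * fourier q v k)"
      by (simp add: cst.hom_mult sum_distrib_left mult.assoc)
    then show ?thesis unfolding L_def by (intro CollectI exI[of _ "\<lambda>k. b * c k"])
  qed
  have L_sum: "sum f A \<in> L" if "\<And>i. i \<in> A \<Longrightarrow> f i \<in> L" for f and A :: "nat set"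
    using that by (induction A rule: infinite_finite_induct) (auto intro: L0 L_add)
  have L_half: "fourier q v k \<in> L" if "k \<in> {1..q div 2}" for k
  proof -
    have "fourier q v k = (\<Sum>l\<in>{1..q div 2}. cst (if l = k then 1 else 0) * fourier q v l)"
      using that by (simp add: if_distrib if_distribR cong: if_cong)
    then show ?thesis unfolding L_def by (intro CollectI exI[of _ "\<lambda>l. if l = k then 1 else 0"])
  qed
  have L_fourier: "fourier q v k \<in> L" if "k < q" for k
  proof -
    have "k = 0 \<or> k \<in> {1..q div 2} \<or> q - k \<in> {1..q div 2}"
      using that unfolding atLeastAtMost_iff by presburger
    then show ?thesis
    proof (elim disjE)
      assume half: "q - k \<in> {1..q div 2}"
      have "fourier q v k = cst (- (?w ^ (q - k))) * fourier q v (q - k)"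
        using fourier_reflect[of "q - k"] that by (simp add: cst.hom_uminus)
      then show ?thesis using L_cst[OF L_half[OF half]] by simp
    qed (auto simp: fourier_0 L0 intro: L_half)
  qed
  have "v j \<in> L"
    by (subst fourier_inversion[OF assms]) (intro L_cst L_sum L_fourier, simp)
  then show ?thesis unfolding L_def by (rule CollectD)
qed

end

section \<open>The ideal of the isospectrality equations\<close>

lemma ord_ge_prod_list: "(\<And>x. x \<in> set xs \<Longrightarrow> f x \<in> ord_ge m 1) \<Longrightarrow>
    prod_list (map f xs) \<in> ord_ge m (length xs)"
proof (induction xs)
  case Nil
  then show ?case using cst_ord_ge[of 1] by simp
next
  case (Cons x xs)
  then show ?case using ord_ge_mult[of "f x" m 1 "prod_list (map f xs)" "length xs"] by simp
qed

lemma single_mset: "Poly_Mapping.single (mset us) c = cst c * prod_list (map ind us)"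
proof (induction us)
  case (Cons i us)
  have "Poly_Mapping.single (mset (i # us)) c = ind i * Poly_Mapping.single (mset us) c"
    by (simp add: ind_def mult_single)
  then show ?case using Cons by (simp add: mult_ac)
qed (simp add: cst_def)

text \<open>A monomial whose degree exceeds the sum of the nilpotency exponents contains some
  variable at least to its own exponent.\<close>

lemma nilpotent_imp_high_order_in_ideal:
  assumes J: "ring_ideal J" and nil: "\<And>i. i < m \<Longrightarrow> \<exists>k. ind i ^ k \<in> J"
  shows "\<exists>d. ord_ge m d \<subseteq> J"
proof -
  obtain e where e: "\<And>i. i < m \<Longrightarrow> ind i ^ e i \<in> J" using nil by metis
  define d where "d = Suc (\<Sum>i<m. e i)"
  have "f \<in> J" if "f \<in> ord_ge m d" for f
    using that unfolding ord_ge_def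
  proof (induction rule: supported_induct)
    case (single a c)
    then have a: "set_mset a \<subseteq> {..<m}" "d \<le> size a" by auto
    have "size a = (\<Sum>i<m. count a i)"
      unfolding size_multiset_overloaded_eq
      by (rule sum.mono_neutral_left) (use a in \<open>auto simp: not_in_iff\<close>)
    have "\<exists>i<m. e i \<le> count a i"
    proof (rule ccontr)
      assume "\<not> ?thesis"
      then have "(\<Sum>i<m. count a i) \<le> (\<Sum>i<m. e i)"
        by (intro sum_mono) (auto simp: not_le)
      then show False using a \<open>size a = _\<close> by (simp add: d_def)
    qed
    then obtain i where i: "i < m" "e i \<le> count a i" by blast
    then obtain a' where "a = a' + replicate_mset (e i) i"
      by (metis count_le_replicate_mset_subset_eq subset_mset.diff_add)
    then have "Poly_Mapping.single a c = Poly_Mapping.single a' c * ind i ^ e i"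
      by (simp add: ind_power mult_single)
    then show ?case using ring_ideal_mult[OF J e[OF i(1)]] by simp
  qed (auto intro: ring_ideal_0[OF J] ring_ideal_add[OF J])
  then show ?thesis by blast
qed

text \<open>By the pigeonhole principle a product of m + 1 of the linear forms y contains a square,
  which can be traded for terms of higher order.\<close>

lemma squares_imp_high_order_in_ideal:
  assumes J: "ring_ideal J" and nil: "\<And>i. i < m \<Longrightarrow> \<exists>k. ind i ^ k \<in> J"
    and y: "\<And>k. y k \<in> ord_ge m 1"
    and sq: "\<And>k. k \<in> {1..m} \<Longrightarrow> \<exists>h\<in>ord_ge m 3. (y k)\<^sup>2 - h \<in> J"
    and span: "\<And>i. i < m \<Longrightarrow> \<exists>c. ind i = (\<Sum>k\<in>{1..m}. cst (c k) * y k)"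
  shows "ord_ge m (m + 1) \<subseteq> J"
proof -
  obtain D where D: "ord_ge m D \<subseteq> J"
    using nilpotent_imp_high_order_in_ideal[OF J nil] by blast
  have step: "ord_ge m d \<subseteq> J" if d: "m + 1 \<le> d" and IH: "ord_ge m (Suc d) \<subseteq> J" for d
  proof -
    \<comment> \<open>Mixed products make the induction possible: expanding one variable by
      \<open>span\<close> moves a factor to the first list, until only the forms \<open>y\<close>
      remain.\<close>
    have prod: "prod_list (map y ks) * prod_list (map ind us) \<in> J"
      if "length ks + length us = d" "set ks \<subseteq> {1..m}" "set us \<subseteq> {..<m}" for ks us
      using that
    proof (induction us arbitrary: ks)
      case Nil
      have "\<not> distinct ks"
      proof
        assume "distinct ks"
        then have "length ks \<le> card {1..m}"
          using Nil by (metis card_mono distinct_card finite_atLeastAtMost)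
        then show False using Nil d by simp
      qed
      then obtain as bs cs k where ks: "ks = as @ [k] @ bs @ [k] @ cs"
        using not_distinct_decomp by blast
      obtain h where h: "h \<in> ord_ge m 3" "(y k)\<^sup>2 - h \<in> J" using sq[of k] Nil ks by auto
      define r where "r = prod_list (map y (as @ bs @ cs))"
      have "r \<in> ord_ge m (length (as @ bs @ cs))"
        unfolding r_def by (rule ord_ge_prod_list) (rule y)
      then have "h * r \<in> ord_ge m (3 + length (as @ bs @ cs))"
        using ord_ge_mult h(1) by blast
      also have "3 + length (as @ bs @ cs) = Suc d" using Nil ks by simp
      finally have "h * r \<in> J" using IH by blast
      moreover have "((y k)\<^sup>2 - h) * r \<in> J" by (rule ring_ideal_mult_right[OF J h(2)])
      ultimately have "((y k)\<^sup>2 - h) * r + h * r \<in> J" by (intro ring_ideal_add[OF J])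
      also have "((y k)\<^sup>2 - h) * r + h * r = prod_list (map y ks)"
        by (simp add: ks r_def power2_eq_square algebra_simps)
      finally show ?case by simp
    next
      case (Cons i us)
      obtain c where c: "ind i = (\<Sum>k\<in>{1..m}. cst (c k) * y k)" using span[of i] Cons.prems by auto
      have "prod_list (map y ks) * prod_list (map ind (i # us)) =
          (\<Sum>k\<in>{1..m}. cst (c k) * (prod_list (map y (k # ks)) * prod_list (map ind us)))"
        by (simp add: c sum_distrib_left sum_distrib_right mult_ac)
      also have "\<dots> \<in> J"
        by (intro ring_ideal_sum[OF J] ring_ideal_mult[OF J] Cons.IH) (use Cons.prems in auto)
      finally show ?case .
    qed
    show ?thesis
    proof
      fix f assume "f \<in> ord_ge m d"
      then show "f \<in> J"
        unfolding ord_ge_def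
      proof (induction rule: supported_induct)
        case (single a c)
        show ?case
        proof (cases "size a = d")
          case True
          obtain us where us: "mset us = a" using ex_mset by blast
          then have "prod_list (map y []) * prod_list (map ind us) \<in> J"
            using single True by (intro prod) auto
          then show ?thesis
            using ring_ideal_mult[OF J] by (simp add: us[symmetric] single_mset)
        next
          case False
          then have "Poly_Mapping.single a c \<in> ord_ge m (Suc d)"
            using single unfolding ord_ge_def by (intro supported_single) auto
          then show ?thesis using IH by blast
        qed
      qed (auto intro: ring_ideal_0[OF J] ring_ideal_add[OF J])
    qed
  qed
  show ?thesis
  \<comment> \<open>Descending induction, starting at a degree where nilpotency already puts
    everything into \<open>J\<close>.\<close>
  proof (rule inc_induct[of "m + 1" "max D (m + 1)"])
    show "ord_ge m (max D (m + 1)) \<subseteq> J"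
      using D ord_ge_mono[of _ m "max D (m + 1)" D] by auto
  qed (use step in auto)
qed

lemma continuant_ideal_cong:
  assumes J: "ring_ideal J" and "\<And>i. i < n \<Longrightarrow> a i - b i \<in> J"
  shows "continuant a n - continuant b n \<in> J"
  using assms(2)
proof (induction a n rule: continuant.induct)
  case (3 a n)
  have "continuant a (Suc (Suc n)) - continuant b (Suc (Suc n)) =
      (a (Suc n) * (continuant a (Suc n) - continuant b (Suc n)) +
      (a (Suc n) - b (Suc n)) * continuant b (Suc n)) - (continuant a n - continuant b n)"
    by (simp add: algebra_simps)
  also have "\<dots> \<in> J"
    by (rule ring_ideal_diff[OF J ring_ideal_add[OF J ring_ideal_mult[OF J]
        ring_ideal_mult_right[OF J]]]) (use 3 in auto)
  finally show ?case .
qed (auto simp: ring_ideal_0[OF J])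

lemma periodic_continuant_ideal_cong:
  assumes J: "ring_ideal J" and "\<And>i. i < q \<Longrightarrow> a i - b i \<in> J" and "q \<ge> 2"
  shows "periodic_continuant q a - periodic_continuant q b \<in> J"
proof -
  have "(continuant a q - continuant b q) -
      (continuant (\<lambda>i. a (Suc i)) (q - 2) - continuant (\<lambda>i. b (Suc i)) (q - 2)) \<in> J"
    by (rule ring_ideal_diff[OF J continuant_ideal_cong[OF J] continuant_ideal_cong[OF J]])
       (use assms in auto)
  then show ?thesis by (simp add: periodic_continuant_def algebra_simps)
qed

section \<open>Cramer's rule, colon ideal and witness monomial\<close>

locale odd_spectral_ideal =
  fixes q :: nat
  assumes q: "q \<ge> 4"
begin

definition m :: nat where "m = q div 2"

abbreviation v :: "nat \<Rightarrow> mvpoly" where "v \<equiv> odd_potential q ind"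

definition G :: "nat \<Rightarrow> mvpoly" where
  "G k = coeff (spectral_diff q v) (q - 2 * (k + 1))"

lemma poly_spectral_diff_G: "poly (spectral_diff q v) x = (\<Sum>k<m. x ^ (q - 2 * (k + 1)) * G k)"
  unfolding G_def m_def using q odd_potential_reflect[of _ q ind]
  by (intro poly_spectral_diff_expand) auto

lemma le_q: "k < m \<Longrightarrow> 2 * (k + 1) \<le> q"
  by (simp add: m_def)

text \<open>Right-hand side of the rewriting rule: \<open>ind j ^ q - T j\<close> is up to sign the
  spectral difference at \<open>ind j\<close>, and the top forms cancel in
  \<open>T j\<close>.\<close>

definition T :: "nat \<Rightarrow> mvpoly" where
  "T j = ind j ^ q + (- 1) ^ q * poly (spectral_diff q v) (ind j)"

sublocale monomial_rewriting m q T
proof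
  fix j assume "j < m"
  then have "T j \<in> deg_le m (q - 2)"
    using spectral_diff_at_ind[of q j] q by (simp add: T_def m_def)
  then show "T j \<in> supported {a. set_mset a \<subseteq> {..<m} \<and> size a < q}"
    unfolding deg_le_def by (rule supported_mono) (use q in auto)
qed

lemma spectral_diff_at_ind_in_annihilator:
  assumes "j < m"
  shows "poly (spectral_diff q v) (ind j) \<in> annihilator"
proof -
  have "- ((- 1) ^ q) * (ind j ^ q - T j) \<in> annihilator"
    by (rule ring_ideal_mult[OF ring_ideal_annihilator relation_in_annihilator[OF assms]])
  also have "- ((- 1) ^ q) * (ind j ^ q - T j) = poly (spectral_diff q v) (ind j)"
    by (cases "even q") (auto simp: T_def)
  finally show ?thesis .
qed

definition power_matrix :: "mvpoly mat" where
  "power_matrix = mat m m (\<lambda>(j, k). ind j ^ (q - 2 * (k + 1)))"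

text \<open>The rewriting relations only put combinations of the \<open>G k\<close> into
  \<open>annihilator\<close>; passing to the colon ideal by the determinant brings in each
  \<open>G k\<close> itself.\<close>

definition J :: "mvpoly set" where "J = {f. det power_matrix * f \<in> annihilator}"

lemma ring_ideal_J: "ring_ideal J" and annihilator_subset_J: "annihilator \<subseteq> J"
  unfolding J_def by (rule ring_ideal_colon[OF ring_ideal_annihilator])+

text \<open>Cramer's rule: \<open>power_matrix\<close> maps the vector of the \<open>G k\<close> to
  the values of the spectral difference at the \<open>ind j\<close>, and the adjugate returns
  \<open>det power_matrix * G k\<close>.\<close>

lemma G_in_J:
  assumes "k < m"
  shows "G k \<in> J"
proof -
  let ?X = power_matrix and ?g = "vec m G" and ?A = "adj_mat power_matrix"
  have X: "?X \<in> carrier_mat m m" by (simp add: power_matrix_def)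
  note A = adj_mat[OF X]
  have "?A *\<^sub>v (?X *\<^sub>v ?g) = (?A * ?X) *\<^sub>v ?g"
    by (rule assoc_mult_mat_vec[symmetric, OF A(1) X]) simp
  also have "\<dots> = det ?X \<cdot>\<^sub>v ?g"
    unfolding A(3) by (rule eq_vecI) (auto simp: scalar_prod_def if_distrib[of "\<lambda>x. _ * x * _"]
        if_distrib[of "\<lambda>x. x * _"] cong: if_cong)
  finally have eq: "?A *\<^sub>v (?X *\<^sub>v ?g) = det ?X \<cdot>\<^sub>v ?g" .
  have B: "(?X *\<^sub>v ?g) $ j = poly (spectral_diff q v) (ind j)" if "j < m" for j
    using that unfolding poly_spectral_diff_G
    by (simp add: power_matrix_def scalar_prod_def atLeast0LessThan)
  have "det ?X * G k = (?A *\<^sub>v (?X *\<^sub>v ?g)) $ k"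
    unfolding eq using assms by simp
  also have "\<dots> = (\<Sum>j<m. ?A $$ (k, j) * poly (spectral_diff q v) (ind j))"
    using assms A(1) X B by (simp add: scalar_prod_def atLeast0LessThan)
  also have "\<dots> \<in> annihilator"
    by (intro ring_ideal_sum ring_ideal_mult ring_ideal_annihilator
        spectral_diff_at_ind_in_annihilator) simp
  finally show ?thesis by (simp add: J_def)
qed

lemma spectral_diff_in_J: "poly (spectral_diff q v) x \<in> J"
  unfolding poly_spectral_diff_G
  by (intro ring_ideal_sum ring_ideal_mult ring_ideal_J G_in_J) simp

text \<open>The exponents 1, 3, 5, ... complement the diagonal of \<open>power_matrix\<close>:
  \<open>q - 2 * (j + 1) + (2 * j + 1) = q - 1\<close>.\<close>

definition witness :: mvpoly where "witness = (\<Prod>j<m. ind j ^ (2 * j + 1))"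

lemma prod_ind_power:
  "(\<Prod>j<n. ind j ^ e j) = Poly_Mapping.single (\<Sum>j<n. replicate_mset (e j) j) 1"
  by (induction n) (auto simp: ind_power mult_single)

text \<open>Only the diagonal term of the Leibniz expansion contributes the top monomial; all others
  have the same degree but contain some variable with an exponent that is at least q.\<close>

lemma witness_notin_J: "witness \<notin> J"
proof -
  define e where "e p j = q - 2 * (p j + 1) + (2 * j + 1)" for p :: "nat \<Rightarrow> nat" and j
  define a where "a p = (\<Sum>j<m. replicate_mset (e p j) j)" for p
  let ?P = "{p. p permutes {0..<m}}"
  have X: "power_matrix \<in> carrier_mat m m" by (simp add: power_matrix_def)
  have perm: "p j < m" if "p \<in> ?P" "j < m" for p j
    using that permutes_in_image[of p "{0..<m}" j] by auto
  have "det power_matrix * witness = (\<Sum>p\<in>?P. signof p * Poly_Mapping.single (a p) 1)"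
  proof -
    have "(\<Prod>j = 0..<m. power_matrix $$ (j, p j)) * witness = Poly_Mapping.single (a p) 1"
      if p: "p \<in> ?P" for p
    proof -
      have "(\<Prod>j = 0..<m. power_matrix $$ (j, p j)) = (\<Prod>j<m. ind j ^ (q - 2 * (p j + 1)))"
        unfolding atLeast0LessThan
        by (rule prod.cong) (auto simp: power_matrix_def perm[OF p])
      then show ?thesis
        by (simp only: witness_def a_def e_def power_add prod.distrib flip: prod_ind_power)
    qed
    then show ?thesis
      by (simp add: det_def'[OF X] sum_distrib_right mult.assoc)
  qed
  then have "top_functional (det power_matrix * witness) =
      (\<Sum>p\<in>?P. top_functional (signof p * Poly_Mapping.single (a p) 1))"
    by (simp add: linear_ext_sum)
  also have "\<dots> = (\<Sum>p\<in>{id}. top_functional (signof p * Poly_Mapping.single (a p) 1))"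
  proof (rule sum.mono_neutral_right)
    show "\<forall>p\<in>?P - {id}. top_functional (signof p * Poly_Mapping.single (a p) 1) = 0"
    proof
      fix p assume p: "p \<in> ?P - {id}"
      have "size (a p) = (\<Sum>j<m. e p j)" by (simp add: a_def)
      also have "\<dots> = (\<Sum>j<m. q - 2 * (p j + 1)) + (\<Sum>j<m. 2 * j + 1)"
        by (simp only: e_def sum.distrib)
      also have "(\<Sum>j<m. q - 2 * (p j + 1)) = (\<Sum>j<m. q - 2 * (j + 1))"
        using sum.permute[of p "{0..<m}" "\<lambda>j. q - 2 * (j + 1)"] p
        by (simp add: atLeast0LessThan comp_def)
      also have "\<dots> + (\<Sum>j<m. 2 * j + 1) = (\<Sum>j<m. q - 1)"
        unfolding sum.distrib[symmetric] by (rule sum.cong) (use le_q in fastforce)+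
      finally have size: "size (a p) = m * (q - 1)" by simp
      have "a p \<noteq> top_mset"
      proof
        assume eq: "a p = top_mset"
        have "p j = j" for j
        proof (cases "j < m")
          case True
          have "count (a p) j = e p j" using True by (simp add: a_def count_sum)
          then have "e p j = q - 1" using eq True by (simp add: count_top_mset)
          moreover have "2 * (p j + 1) \<le> q" using le_q perm p True by auto
          ultimately show ?thesis by (simp add: e_def)
        next
          case False
          then show ?thesis using p by (auto simp: permutes_def)
        qed
        then show False using p by auto
      qed
      then have "top_coeff (a p) = 0" by (intro top_coeff_eq_0) (simp_all add: size)
      then show "top_functional (signof p * Poly_Mapping.single (a p) 1) = 0"
        by (auto simp: sign_def linear_ext_uminus)
    qed
  qed (auto simp: permutes_id finite_permutations)
  also have "\<dots> = 1"
  proof -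
    have "e id j = q - 1" if "j < m" for j using le_q[OF that] by (simp add: e_def)
    then have "a id = top_mset" by (simp add: a_def top_mset_def)
    then show ?thesis using q by (simp add: top_coeff_top_mset)
  qed
  finally have "top_functional (det power_matrix * witness * 1) \<noteq> 0" by simp
  then show ?thesis unfolding J_def annihilator_def by blast
qed

text \<open>The first \<open>m\<close> odd numbers sum to \<open>m * m\<close>, and
  \<open>q \<ge> 4\<close> makes \<open>m \<ge> 2\<close>.\<close>

lemma witness_ord_ge: "witness \<in> ord_ge m (m + 1)"
proof -
  have "(\<Sum>j<n. 2 * j + 1) = n * n" for n :: nat
    by (induction n) auto
  then have "size (\<Sum>j<m. replicate_mset (2 * j + 1) j) = m * m"
    by (simp only: size_multiset_sum size_replicate_mset)
  moreover have "m + 1 \<le> m * m"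
  proof -
    have "2 \<le> m" using q by (simp add: m_def)
    then have "2 * m \<le> m * m" by (rule mult_le_mono1)
    then show ?thesis using \<open>2 \<le> m\<close> by linarith
  qed
  ultimately show ?thesis
    unfolding witness_def prod_ind_power ord_ge_def
    by (intro supported_single) (auto simp: set_mset_sum split: if_splits)
qed

text \<open>The third order remainder of the expansion serves as \<open>h\<close>; what is left is a
  multiple of a spectral difference.\<close>

lemma fourier_square_mod_J:
  assumes "k \<in> {1..m}"
  shows "\<exists>h\<in>ord_ge m 3. (fourier q v k)\<^sup>2 - h \<in> J"
proof -
  have k: "0 < k" "k < q" using assms q by (auto simp: m_def)
  have "0 < q" using q by simp
  then obtain c x where cx: "(fourier q v k)\<^sup>2 - cst c * poly (spectral_diff q v) x \<in> ord_ge m 3"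
    using spectral_diff_second_order[of q v k m] k odd_potential_reflect odd_potential_ord_ge
    by (fastforce simp: m_def)
  have "cst c * poly (spectral_diff q v) x \<in> J"
    by (intro ring_ideal_mult ring_ideal_J spectral_diff_in_J)
  then show ?thesis by (intro bexI[OF _ cx]) simp
qed

lemma ind_in_fourier_span:
  assumes "i < m"
  shows "\<exists>c. ind i = (\<Sum>k\<in>{1..m}. cst (c k) * fourier q v k)"
proof -
  have "v i = ind i" using assms by (simp add: odd_potential_def m_def)
  moreover have "\<exists>c. v i = (\<Sum>k\<in>{1..q div 2}. cst (c k) * fourier q v k)"
    using assms q odd_potential_reflect by (intro fourier_half_span) (auto simp: m_def)
  ultimately show ?thesis by (simp only: m_def)
qed

text \<open>If all variables were nilpotent modulo \<open>J\<close>, everything of order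
  \<open>m + 1\<close> would lie in \<open>J\<close>, including \<open>witness\<close>. The other
  branch of the dichotomy is the claim.\<close>

lemma exists_nonzero_value:
  "\<exists>c J'. ring_ideal J' \<and> J \<subseteq> J' \<and> 1 \<notin> J' \<and> (\<forall>i<m. ind i - cst (c i) \<in> J') \<and> (\<exists>i<m. c i \<noteq> 0)"
proof -
  have "\<not> (\<forall>i<m. \<exists>k. ind i ^ k \<in> J)"
  proof
    assume nil: "\<forall>i<m. \<exists>k. ind i ^ k \<in> J"
    have "fourier q v k \<in> ord_ge m 1" for k
      unfolding m_def using q odd_potential_reflect odd_potential_ord_ge
      by (intro fourier_ord_ge) auto
    then have "ord_ge m (m + 1) \<subseteq> J"
      using nil fourier_square_mod_J ind_in_fourier_span
      by (intro squares_imp_high_order_in_ideal[OF ring_ideal_J, where y = "fourier q v"]) auto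
    then show False using witness_ord_ge witness_notin_J by blast
  qed
  moreover have "\<exists>p. p \<noteq> 0 \<and> poly (map_poly cst p) (ind i) \<in> J" if "i < m" for i
    using ind_algebraic[OF that] annihilator_subset_J by blast
  ultimately show ?thesis
    using nilpotent_or_nonzero_joint_value[OF cst.comm_ring_hom_axioms ring_ideal_J, of m ind]
    by blast
qed

text \<open>Modulo \<open>J'\<close> the generic potential is congruent to constants
  \<open>V\<close>. The spectral difference of \<open>V\<close> is thus a constant in a proper
  ideal, hence 0.\<close>

lemma exists_isospectral_potential:
  "\<exists>V :: nat \<Rightarrow> complex. (\<exists>i<q. V i \<noteq> 0) \<and>
    (\<forall>lam. periodic_continuant q (\<lambda>i. V i - lam) = periodic_continuant q (\<lambda>i. - lam))"
proof -
  obtain c J' where J': "ring_ideal J'" "J \<subseteq> J'" "1 \<notin> J'"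
    and c: "\<And>i. i < m \<Longrightarrow> ind i - cst (c i) \<in> J'" and nz: "\<exists>i<m. c i \<noteq> 0"
    using exists_nonzero_value by blast
  define V where "V = odd_potential q c"
  obtain i where "i < m" "c i \<noteq> 0" using nz by blast
  then have "\<exists>i<q. V i \<noteq> 0"
    by (intro exI[of _ i]) (auto simp: V_def odd_potential_def m_def)
  moreover have "periodic_continuant q (\<lambda>i. V i - lam) = periodic_continuant q (\<lambda>i. - lam)" for lam
  proof (rule ccontr)
    let ?d = "periodic_continuant q (\<lambda>i. V i - lam) - periodic_continuant q (\<lambda>i. - lam)"
    assume "\<not> ?thesis"
    then have d: "?d \<noteq> 0" by simp
    have hom: "cst (periodic_continuant q a) = periodic_continuant q (\<lambda>i. cst (a i))" for a
      by (rule periodic_continuant_hom) (auto simp: cst.hom_minus cst.hom_mult)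
    have cong: "v i - cst (V i) \<in> J'" for i
    proof -
      consider "i < m" | "\<not> i < m" "q - 1 - i < m" | "\<not> i < m" "\<not> q - 1 - i < m" by blast
      then show ?thesis
      proof cases
        case 2
        then have "v i - cst (V i) = - (ind (q - 1 - i) - cst (c (q - 1 - i)))"
          by (simp add: V_def odd_potential_def m_def cst.hom_uminus)
        then show ?thesis using ring_ideal_uminus[OF J'(1) c[OF 2(2)]] by simp
      qed (use c ring_ideal_0[OF J'(1)] in \<open>auto simp: V_def odd_potential_def m_def\<close>)
    qed
    have "periodic_continuant q (\<lambda>i. v i - cst lam) - periodic_continuant q (\<lambda>i. cst (V i - lam)) \<in> J'"
      using q cong by (intro periodic_continuant_ideal_cong J'(1)) (simp_all add: cst.hom_minus)
    moreover have "poly (spectral_diff q v) (cst lam) \<in> J'"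
      using spectral_diff_in_J J'(2) by blast
    ultimately have "poly (spectral_diff q v) (cst lam) - (periodic_continuant q (\<lambda>i. v i - cst lam)
        - periodic_continuant q (\<lambda>i. cst (V i - lam))) \<in> J'"
      by (rule ring_ideal_diff[OF J'(1), rotated])
    also have "poly (spectral_diff q v) (cst lam) - (periodic_continuant q (\<lambda>i. v i - cst lam)
        - periodic_continuant q (\<lambda>i. cst (V i - lam))) = cst ?d"
      by (simp add: poly_spectral_diff cst.hom_minus cst.hom_uminus hom)
    finally have "cst (inverse ?d) * cst ?d \<in> J'" by (rule ring_ideal_mult[OF J'(1)])
    moreover have "cst (inverse ?d) * cst ?d = 1"
      using cst_inverse[OF d] by (simp only: mult.commute)
    ultimately show False using J'(3) by simp
  qed
  ultimately show ?thesis by blast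
qed

end

theorem theorem4p4:
  fixes q :: nat
  assumes "q \<ge> 4"
  shows "\<exists>V :: nat \<Rightarrow> complex. (\<exists>i<q. V i \<noteq> 0) \<and>
           (\<forall>z lam. z \<noteq> 0 \<longrightarrow> floquet_det q V z lam = floquet_det q (\<lambda>_. 0) z lam)"
proof -
  interpret odd_spectral_ideal q by unfold_locales (rule assms)
  obtain V :: "nat \<Rightarrow> complex" where "\<exists>i<q. V i \<noteq> 0"
    and "\<And>lam. periodic_continuant q (\<lambda>i. V i - lam) = periodic_continuant q (\<lambda>i. - lam)"
    using exists_isospectral_potential by blast
  \<comment> \<open>The terms in \<open>z\<close> agree for all potentials, so equality of the
    periodic continuants suffices.\<close>
  then show ?thesis
    by (intro exI[of _ V]) (simp add: floquet_det_eq[OF assms])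
qed

end
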